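(* Let $p \geq 4$ and $N \geq 1$ be integers. Then there exist unique integers $m \geq t \geq 0$ and $r$ with $0 \leq r < \binom{t+p-4}{p-4}$ such that $$N-1 = \binom{m+p-3}{p-2} + \binom{t+p-4}{p-3} + r,$$ and for these $m$ and $t$ we have $$H(p, N) \geq (m+t)\,2^{m-2(p-2)}.$$
   Context: Consider the Towers of Hanoi puzzle with $p$ pegs, labelled by $\{0,1,\ldots,p-1\}$, and $N$ disks of pairwise different sizes, labelled by $\{0,1,\ldots,N-1\}$ in increasing order of size (disk $0$ is the smallest). On each peg, disks are stacked so that no disk lies on top of a smaller one; thus a configuration is a function $\mathbf{u}:\{0,\ldots,N-1\}\to\{0,\ldots,p-1\}$ giving the peg of each disk. A legal move takes the topmost disk on some peg and places it on another peg that is either empty or whose topmost disk is larger; that is, disk $D$ may be moved from peg $x$ to peg $y\neq x$ exactly when no disk smaller than $D$ lies on peg $x$ or peg $y$. Only one disk is moved at a time. $H(p,N)$ denotes the minimum number of legal moves needed to move all $N$ disks from one peg to another, i.e. to get from the configuration with all $N$ disks on one given peg to the configuration with all $N$ disks on another given peg, using $p$ pegs (by symmetry this does not depend on the choice of the two distinct pegs). Convention: $\binom{a}{b}$ is the usual binomial coefficient for integers $a,b\ge 0$, with $\binom{a}{b}=0$ if $a<b$. *)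

theory Defs
  imports Complex_Main "HOL-Library.FuncSet"
begin

definition hanoi_configs :: "nat \<Rightarrow> nat \<Rightarrow> (nat \<Rightarrow> nat) set" where
  "hanoi_configs p N = {..<N} \<rightarrow>\<^sub>E {..<p}"

definition hanoi_moves :: "nat \<Rightarrow> nat \<Rightarrow> ((nat \<Rightarrow> nat) \<times> (nat \<Rightarrow> nat)) set" where
  "hanoi_moves p N = {(u, u(D := y)) | u D y.
     u \<in> hanoi_configs p N \<and> D < N \<and> y < p \<and> y \<noteq> u D \<and>
     (\<forall>d<D. u d \<noteq> u D \<and> u d \<noteq> y)}"

definition hanoi_tower :: "nat \<Rightarrow> nat \<Rightarrow> (nat \<Rightarrow> nat)" where
  "hanoi_tower N x = (\<lambda>d\<in>{..<N}. x)"

definition hanoi_dist :: "nat \<Rightarrow> nat \<Rightarrow> nat \<Rightarrow> nat \<Rightarrow> nat" where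
  "hanoi_dist p N x y = (LEAST n. (hanoi_tower N x, hanoi_tower N y) \<in> hanoi_moves p N ^^ n)"

(* The choice of the pegs 0 and 1 is immaterial, and the minimum is over a
   nonempty set for p \<ge> 3: see hanoi_dist_eq_H and hanoi_tower_reachable. *)
definition H :: "nat \<Rightarrow> nat \<Rightarrow> nat" where
  "H p N = hanoi_dist p N 0 1"

lemma hanoi_moves_lift:
  assumes "(u, v) \<in> hanoi_moves p N" "z < p"
  shows "(u(N := z), v(N := z)) \<in> hanoi_moves p (Suc N)"
proof -
  obtain D y where D: "v = u(D := y)" "u \<in> hanoi_configs p N" "D < N" "y < p" "y \<noteq> u D"
    "\<forall>d<D. u d \<noteq> u D \<and> u d \<noteq> y"
    using assms(1) unfolding hanoi_moves_def by auto
  have "u(N := z) \<in> hanoi_configs p (Suc N)"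
    using D(2) assms(2) unfolding hanoi_configs_def
    by (auto simp: PiE_iff extensional_def less_Suc_eq)
  moreover have "v(N := z) = (u(N := z))(D := y)"
    using D(1,3) by (auto simp: fun_eq_iff)
  ultimately show ?thesis
    using D unfolding hanoi_moves_def by (intro CollectI exI[of _ "u(N := z)"] exI[of _ D] exI[of _ y]) auto
qed

lemma hanoi_moves_lift_rtrancl:
  assumes "(u, v) \<in> (hanoi_moves p N)\<^sup>*" "z < p"
  shows "(u(N := z), v(N := z)) \<in> (hanoi_moves p (Suc N))\<^sup>*"
  using assms(1)
  by (induction rule: rtrancl_induct) (blast intro: rtrancl_into_rtrancl hanoi_moves_lift[OF _ assms(2)])+

lemma hanoi_tower_Suc: "hanoi_tower (Suc N) x = (hanoi_tower N x)(N := x)"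
  by (auto simp: hanoi_tower_def fun_eq_iff)

lemma hanoi_tower_reachable:
  assumes "p \<ge> 3" "x < p" "y < p" "x \<noteq> y"
  shows "(hanoi_tower N x, hanoi_tower N y) \<in> (hanoi_moves p N)\<^sup>*"
  using assms(2-4)
proof (induction N arbitrary: x y)
  case 0
  then show ?case by (simp add: hanoi_tower_def)
next
  case (Suc N)
  have "card {x, y} < card {..<p}" using assms(1) Suc.prems by simp
  then have "\<not> {..<p} \<subseteq> {x, y}" by (meson card_mono finite.emptyI finite.insertI leD)
  then obtain z where z: "z < p" "z \<noteq> x" "z \<noteq> y" by auto
  have 1: "((hanoi_tower N x)(N := x), (hanoi_tower N z)(N := x)) \<in> (hanoi_moves p (Suc N))\<^sup>*"
    using Suc z by (intro hanoi_moves_lift_rtrancl) auto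
  have 2: "((hanoi_tower N z)(N := x), (hanoi_tower N z)(N := y)) \<in> hanoi_moves p (Suc N)"
    unfolding hanoi_moves_def
    by (intro CollectI exI[of _ "(hanoi_tower N z)(N := x)"] exI[of _ N] exI[of _ y])
      (use Suc.prems z in \<open>auto simp: hanoi_configs_def hanoi_tower_def PiE_iff extensional_def\<close>)
  have 3: "((hanoi_tower N z)(N := y), (hanoi_tower N y)(N := y)) \<in> (hanoi_moves p (Suc N))\<^sup>*"
    using Suc z by (intro hanoi_moves_lift_rtrancl) auto
  show ?case unfolding hanoi_tower_Suc using 1 2 3
    by (meson rtrancl_into_rtrancl rtrancl_trans)
qed

lemma hanoi_moves_relabel:
  assumes f: "bij_betw f {..<p} {..<p}" and m: "(u, v) \<in> hanoi_moves p N"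
  shows "(restrict (f \<circ> u) {..<N}, restrict (f \<circ> v) {..<N}) \<in> hanoi_moves p N"
proof -
  obtain D y where D: "v = u(D := y)" "u \<in> hanoi_configs p N" "D < N" "y < p" "y \<noteq> u D"
    "\<forall>d<D. u d \<noteq> u D \<and> u d \<noteq> y"
    using m unfolding hanoi_moves_def by auto
  have u: "u d < p" if "d < N" for d
    using D(2) that unfolding hanoi_configs_def by auto
  have f1: "f a < p" if "a < p" for a
    using f that unfolding bij_betw_def by auto
  have f2: "f a = f b \<longleftrightarrow> a = b" if "a < p" "b < p" for a b
    using f that unfolding bij_betw_def inj_on_def by auto
  show ?thesis unfolding hanoi_moves_def
    by (intro CollectI exI[of _ "restrict (f \<circ> u) {..<N}"] exI[of _ D] exI[of _ "f y"])
      (use D u f1 f2 in \<open>auto simp: hanoi_configs_def fun_eq_iff\<close>)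
qed

lemma hanoi_relpow_relabel:
  assumes f: "bij_betw f {..<p} {..<p}" and "(u, v) \<in> hanoi_moves p N ^^ n"
  shows "(restrict (f \<circ> u) {..<N}, restrict (f \<circ> v) {..<N}) \<in> hanoi_moves p N ^^ n"
  using assms(2)
proof (induction n arbitrary: v)
  case (Suc n)
  then show ?case by (blast elim: relpow_Suc_E intro: relpow_Suc_I hanoi_moves_relabel[OF f])
qed auto

lemma hanoi_relpow_tower_mono:
  assumes "x < p" "y < p" "x \<noteq> y" "x' < p" "y' < p" "x' \<noteq> y'"
    and n: "(hanoi_tower N x, hanoi_tower N y) \<in> hanoi_moves p N ^^ n"
  shows "(hanoi_tower N x', hanoi_tower N y') \<in> hanoi_moves p N ^^ n"
proof -
  have card: "card ({..<p} - {x, y}) = card ({..<p} - {x', y'})"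
    using assms by (simp add: card_Diff_subset)
  obtain g where g: "bij_betw g ({..<p} - {x, y}) ({..<p} - {x', y'})"
    using card by (metis finite_Diff finite_lessThan finite_same_card_bij)
  define f where "f = (\<lambda>a. if a = x then x' else if a = y then y' else g a)"
  have "bij_betw f ({..<p} - {x, y}) ({..<p} - {x', y'})"
    using g by (subst bij_betw_cong[of _ f g]) (auto simp: f_def)
  moreover have "bij_betw f {x, y} {x', y'}"
    using assms by (auto simp: f_def bij_betw_def inj_on_def)
  ultimately have "bij_betw f (({..<p} - {x, y}) \<union> {x, y}) (({..<p} - {x', y'}) \<union> {x', y'})"
    by (intro bij_betw_combine) auto
  moreover have "({..<p} - {x, y}) \<union> {x, y} = {..<p}" "({..<p} - {x', y'}) \<union> {x', y'} = {..<p}"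
    using assms by auto
  ultimately have f: "bij_betw f {..<p} {..<p}" by simp
  have "restrict (f \<circ> hanoi_tower N x) {..<N} = hanoi_tower N x'"
    "restrict (f \<circ> hanoi_tower N y) {..<N} = hanoi_tower N y'"
    using assms by (auto simp: hanoi_tower_def f_def fun_eq_iff)
  then show ?thesis using hanoi_relpow_relabel[OF f n] by simp
qed

lemma hanoi_dist_eq_H:
  assumes "x < p" "y < p" "x \<noteq> y"
  shows "hanoi_dist p N x y = H p N"
proof -
  have "p > 1" using assms by linarith
  then have "(hanoi_tower N x, hanoi_tower N y) \<in> hanoi_moves p N ^^ n \<longleftrightarrow>
      (hanoi_tower N 0, hanoi_tower N 1) \<in> hanoi_moves p N ^^ n" for n
    using assms hanoi_relpow_tower_mono[of x p y 0 1 N n] hanoi_relpow_tower_mono[of 0 p 1 x y N n]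
    by linarith
  then show ?thesis unfolding H_def hanoi_dist_def by simp
qed

end

theory Submission
  imports Defs "HOL-Library.Infinite_Set"
begin

text \<open>
  The proof bounds the number of moves of a path along which every disk of a set \<open>S\<close> moves at least
  once, whatever the initial configuration. Let \<open>F\<close> be the set of disks not yet moved at time \<open>s\<close> and
  \<open>L\<close> the set of those not moved any more after it, and choose \<open>s\<close> such that \<open>F\<close> has \<open>K\<close> elements. If
  \<open>L\<close> has at most \<open>K\<close> elements, then at least \<open>card S - K\<close> disks move in both halves of the path.
  Otherwise compare \<open>Min F\<close> with \<open>Min L\<close>: the smaller of these two disks rests during one half of
  the path and blocks its peg for all the disks of the other set, which all move in that half; so
  \<open>K\<close> disks have been moved on \<open>p - 1\<close> pegs. This gives an induction on the number of pegs.

  For four pegs the bound comes from Bousch's inequality: emptying a peg that carries the tower \<open>E\<close>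
  takes at least \<open>psi L E\<close> moves, if finally two pegs are empty. At a move of the largest disk the
  others lie on two pegs, and each of them moves before or after that time, so they split
  into four such towers. Finally, in the tower problem all but the largest disk move
  before its first move and again after its last one.
\<close>

section \<open>Paths, move counts and moved disks\<close>

text \<open>Idle steps and moves of disks outside \<open>S\<close> are allowed, so that a path
  restricts to subsets of the disks and to subintervals of time. \<open>move_count\<close> counts
  only the steps at which a disk of \<open>S\<close> moves, and a disk that later returns to its peg
  still counts as \<open>moved\<close>.\<close>

definition hanoi_path :: "nat set \<Rightarrow> nat set \<Rightarrow> (nat \<Rightarrow> nat \<Rightarrow> nat) \<Rightarrow> nat \<Rightarrow> nat \<Rightarrow> bool" where
  "hanoi_path S P w a b \<longleftrightarrow> a \<le> b \<and> (\<forall>i d. a \<le> i \<longrightarrow> i \<le> b \<longrightarrow> d \<in> S \<longrightarrow> w i d \<in> P) \<and>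
     (\<forall>i D d. a \<le> i \<longrightarrow> i < b \<longrightarrow> D \<in> S \<longrightarrow> d \<in> S \<longrightarrow> d \<noteq> D \<longrightarrow> w (Suc i) D \<noteq> w i D \<longrightarrow>
        w (Suc i) d = w i d \<and> (d < D \<longrightarrow> w i d \<noteq> w i D \<and> w i d \<noteq> w (Suc i) D))"

definition move_count :: "nat set \<Rightarrow> (nat \<Rightarrow> nat \<Rightarrow> nat) \<Rightarrow> nat \<Rightarrow> nat \<Rightarrow> nat" where
  "move_count S w a b = card {i. a \<le> i \<and> i < b \<and> (\<exists>d\<in>S. w (Suc i) d \<noteq> w i d)}"

definition moved :: "(nat \<Rightarrow> nat \<Rightarrow> nat) \<Rightarrow> nat \<Rightarrow> nat \<Rightarrow> nat \<Rightarrow> bool" where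
  "moved w a b d \<longleftrightarrow> (\<exists>i. a \<le> i \<and> i < b \<and> w (Suc i) d \<noteq> w i d)"

lemma hanoi_path_le: "hanoi_path S P w a b \<Longrightarrow> a \<le> b"
  by (simp add: hanoi_path_def)

lemma hanoi_path_in: "hanoi_path S P w a b \<Longrightarrow> a \<le> i \<Longrightarrow> i \<le> b \<Longrightarrow> d \<in> S \<Longrightarrow> w i d \<in> P"
  by (simp add: hanoi_path_def)

lemma hanoi_path_others:
  "hanoi_path S P w a b \<Longrightarrow> a \<le> i \<Longrightarrow> i < b \<Longrightarrow> D \<in> S \<Longrightarrow> d \<in> S \<Longrightarrow> d \<noteq> D \<Longrightarrow>
    w (Suc i) D \<noteq> w i D \<Longrightarrow> w (Suc i) d = w i d"
  unfolding hanoi_path_def by blast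

lemma hanoi_path_smaller:
  assumes "hanoi_path S P w a b" "a \<le> i" "i < b" "D \<in> S" "d \<in> S" "d < D" "w (Suc i) D \<noteq> w i D"
  shows "w i d \<noteq> w i D" "w i d \<noteq> w (Suc i) D"
  using assms unfolding hanoi_path_def by blast+

lemma hanoi_path_mono:
  assumes "hanoi_path S P w a b" "S' \<subseteq> S" "a \<le> a'" "a' \<le> b'" "b' \<le> b"
  shows "hanoi_path S' P w a' b'"
  unfolding hanoi_path_def
proof (intro conjI allI impI)
  fix i d assume "a' \<le> i" "i \<le> b'" "d \<in> S'"
  then show "w i d \<in> P" using assms by (intro hanoi_path_in[OF assms(1)]) auto
next
  fix i D d assume *: "a' \<le> i" "i < b'" "D \<in> S'" "d \<in> S'" "d \<noteq> D" "w (Suc i) D \<noteq> w i D"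
  then have **: "a \<le> i" "i < b" "D \<in> S" "d \<in> S" using assms by auto
  show "w (Suc i) d = w i d" using hanoi_path_others[OF assms(1)] * ** by blast
  show "w i d \<noteq> w i D" "w i d \<noteq> w (Suc i) D" if "d < D"
    using hanoi_path_smaller[OF assms(1)] * ** that by blast+
qed (use assms in auto)

text \<open>The rule for a move is symmetric in its two pegs, and the smaller disks rest during the
  move, so it can be undone.\<close>

lemma hanoi_path_rev:
  assumes "hanoi_path S P w a b"
  shows "hanoi_path S P (\<lambda>i. w (a + b - i)) a b"
  unfolding hanoi_path_def
proof (intro conjI allI impI)
  fix i d assume "a \<le> i" "i \<le> b" "d \<in> S"
  then show "w (a + b - i) d \<in> P" by (intro hanoi_path_in[OF assms]) auto
next
  fix i D d assume *: "a \<le> i" "i < b" "D \<in> S" "d \<in> S" "d \<noteq> D"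
    "w (a + b - Suc i) D \<noteq> w (a + b - i) D"
  have s: "Suc (a + b - Suc i) = a + b - i" "a \<le> a + b - Suc i" "a + b - Suc i < b"
    using * by linarith+
  have mvD: "w (Suc (a + b - Suc i)) D \<noteq> w (a + b - Suc i) D" using * s by simp
  note oth = hanoi_path_others[OF assms s(2,3) *(3,4,5) mvD]
  show "w (a + b - Suc i) d = w (a + b - i) d" using oth s by simp
  show "w (a + b - i) d \<noteq> w (a + b - i) D" "w (a + b - i) d \<noteq> w (a + b - Suc i) D" if "d < D"
    using hanoi_path_smaller[OF assms s(2,3) *(3,4) that mvD] oth s by simp_all
qed (rule hanoi_path_le[OF assms])

lemma move_count_split:
  assumes "a \<le> c" "c \<le> b"
  shows "move_count S w a b = move_count S w a c + move_count S w c b"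
proof -
  have "{i. a \<le> i \<and> i < b \<and> (\<exists>d\<in>S. w (Suc i) d \<noteq> w i d)} =
      {i. a \<le> i \<and> i < c \<and> (\<exists>d\<in>S. w (Suc i) d \<noteq> w i d)} \<union>
      {i. c \<le> i \<and> i < b \<and> (\<exists>d\<in>S. w (Suc i) d \<noteq> w i d)}"
    using assms by auto
  moreover have "card \<dots> = move_count S w a c + move_count S w c b"
    unfolding move_count_def by (rule card_Un_disjoint) auto
  ultimately show ?thesis unfolding move_count_def by simp
qed

lemma move_count_subinterval:
  assumes "a \<le> a'" "b' \<le> b"
  shows "move_count S w a' b' \<le> move_count S w a b"
  unfolding move_count_def using assms by (intro card_mono) auto

lemma move_count_mono:
  assumes "S' \<subseteq> S"
  shows "move_count S' w a b \<le> move_count S w a b"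
  unfolding move_count_def using assms by (intro card_mono) auto

text \<open>At most one disk moves per step, so no step is counted for both sets.\<close>

lemma move_count_disjoint:
  assumes "hanoi_path S P w a b" "A \<subseteq> S" "B \<subseteq> S" "A \<inter> B = {}"
  shows "move_count A w a b + move_count B w a b \<le> move_count S w a b"
proof -
  have "move_count A w a b + move_count B w a b =
    card ({i. a \<le> i \<and> i < b \<and> (\<exists>d\<in>A. w (Suc i) d \<noteq> w i d)} \<union>
      {i. a \<le> i \<and> i < b \<and> (\<exists>d\<in>B. w (Suc i) d \<noteq> w i d)})"
    unfolding move_count_def
  proof (rule card_Un_disjoint[symmetric])
    show "{i. a \<le> i \<and> i < b \<and> (\<exists>d\<in>A. w (Suc i) d \<noteq> w i d)} \<inter>
      {i. a \<le> i \<and> i < b \<and> (\<exists>d\<in>B. w (Suc i) d \<noteq> w i d)} = {}"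
    proof (rule ccontr)
      assume "\<not> ?thesis"
      then obtain i d d' where i: "a \<le> i" "i < b" "d \<in> A" "d' \<in> B"
        "w (Suc i) d \<noteq> w i d" "w (Suc i) d' \<noteq> w i d'" by auto
      then show False using hanoi_path_others[OF assms(1) i(1,2), of d d'] assms by blast
    qed
  qed auto
  also have "\<dots> \<le> move_count S w a b"
    unfolding move_count_def using assms(2,3) by (intro card_mono) auto
  finally show ?thesis .
qed

lemma move_count_step:
  assumes "d \<in> S" "a \<le> i" "i < b" "w (Suc i) d \<noteq> w i d"
  shows "1 \<le> move_count S w a b"
proof -
  have "card {i} \<le> move_count S w a b"
    unfolding move_count_def using assms by (intro card_mono) auto
  then show ?thesis by simp
qed

lemma move_count_rev: "a \<le> b \<Longrightarrow> move_count S (\<lambda>i. w (a + b - i)) a b = move_count S w a b"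
  unfolding move_count_def
\<comment> \<open>Step \<open>i\<close> of the reversed path undoes step
  \<open>a + b - Suc i\<close>.\<close>
proof (rule bij_betw_same_card[of "\<lambda>i. a + b - Suc i"], rule bij_betw_byWitness[where f' = "\<lambda>i. a + b - Suc i"])
  show "(\<lambda>i. a + b - Suc i) ` {i. a \<le> i \<and> i < b \<and> (\<exists>d\<in>S. w (a + b - Suc i) d \<noteq> w (a + b - i) d)}
    \<subseteq> {i. a \<le> i \<and> i < b \<and> (\<exists>d\<in>S. w (Suc i) d \<noteq> w i d)}"
  proof safe
    fix i d assume "a \<le> i" "i < b" "d \<in> S" "w (a + b - Suc i) d \<noteq> w (a + b - i) d"
    moreover have "Suc (a + b - Suc i) = a + b - i" using \<open>i < b\<close> by simp
    ultimately show "\<exists>d\<in>S. w (Suc (a + b - Suc i)) d \<noteq> w (a + b - Suc i) d" by metis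
  qed auto
  show "(\<lambda>i. a + b - Suc i) ` {i. a \<le> i \<and> i < b \<and> (\<exists>d\<in>S. w (Suc i) d \<noteq> w i d)}
    \<subseteq> {i. a \<le> i \<and> i < b \<and> (\<exists>d\<in>S. w (a + b - Suc i) d \<noteq> w (a + b - i) d)}"
  proof safe
    fix i d assume "a \<le> i" "i < b" "d \<in> S" "w (Suc i) d \<noteq> w i d"
    moreover have "a + b - Suc (a + b - Suc i) = i" "a + b - (a + b - Suc i) = Suc i"
      using \<open>i < b\<close> \<open>a \<le> i\<close> by simp_all
    ultimately show "\<exists>d\<in>S. w (a + b - Suc (a + b - Suc i)) d \<noteq> w (a + b - (a + b - Suc i)) d"
      by metis
  qed auto
qed auto

lemma first_exit:
  fixes Q :: "nat \<Rightarrow> bool"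
  assumes "a \<le> b" "Q a" "\<not> Q b"
  obtains i where "a \<le> i" "i < b" "\<And>k. a \<le> k \<Longrightarrow> k \<le> i \<Longrightarrow> Q k" "\<not> Q (Suc i)"
proof -
  define n where "n = (LEAST n. a \<le> n \<and> \<not> Q n)"
  have n: "a \<le> n" "\<not> Q n" and le: "n \<le> b"
    unfolding n_def using LeastI[of "\<lambda>n. a \<le> n \<and> \<not> Q n" b] Least_le[of "\<lambda>n. a \<le> n \<and> \<not> Q n" b] assms
    by auto
  have before: "Q k" if "a \<le> k" "k < n" for k
    using not_less_Least[of k "\<lambda>n. a \<le> n \<and> \<not> Q n"] that unfolding n_def by auto
  have "n \<noteq> a" using n assms by auto
  then obtain i where i: "n = Suc i" "a \<le> i" using n(1) by (cases n) auto
  show thesis using that[of i] i before n le by auto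
qed

lemma last_exit:
  fixes Q :: "nat \<Rightarrow> bool"
  assumes "a \<le> b" "Q a" "\<not> Q b"
  obtains i where "a \<le> i" "i < b" "Q i" "\<And>k. i < k \<Longrightarrow> k \<le> b \<Longrightarrow> \<not> Q k"
proof -
  define A where "A = {i. a \<le> i \<and> i \<le> b \<and> Q i}"
  have A: "finite A" "a \<in> A" using assms by (auto simp: A_def)
  have M: "Max A \<in> A" using A by (intro Max_in) auto
  show thesis
  proof (rule that[of "Max A"])
    show "a \<le> Max A" "Q (Max A)" using M by (auto simp: A_def)
    show "Max A < b" using M assms by (auto simp: A_def order_less_le)
    fix k assume k: "Max A < k" "k \<le> b"
    show "\<not> Q k"
    proof
      assume "Q k"
      then have "k \<in> A" using k M by (auto simp: A_def)
      then show False using Max_ge[OF A(1)] k by fastforce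
    qed
  qed
qed

lemma not_moved_const:
  assumes "\<not> moved w a b d" "a \<le> k" "k \<le> b"
  shows "w k d = w a d"
  using assms(2,3)
proof (induction k rule: dec_induct)
  case (step n) then show ?case using assms(1) by (auto simp: moved_def)
qed auto

lemma moved_change:
  assumes "w i d \<noteq> w k d" "a \<le> i" "i \<le> b" "a \<le> k" "k \<le> b"
  shows "moved w a b d"
  using not_moved_const[of w a b d] assms by metis

lemma moved_rev: "moved (\<lambda>i. w (a + b - i)) a b d \<longleftrightarrow> moved w a b d"
proof -
  have *: "moved (\<lambda>i. w (a + b - i)) a b d" if m: "moved w a b d" for w
  proof -
    obtain i where i: "a \<le> i" "i < b" "w (Suc i) d \<noteq> w i d" using m by (auto simp: moved_def)
    have e: "a + b - Suc (a + b - Suc i) = i" "a + b - (a + b - Suc i) = Suc i"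
      using i by simp_all
    show ?thesis unfolding moved_def
      by (rule exI[of _ "a + b - Suc i"], unfold e) (use i in auto)
  qed
  have "moved w a b d" if m: "moved (\<lambda>i. w (a + b - i)) a b d"
  proof -
    obtain i where i: "a \<le> i" "i < b" "w (a + b - Suc i) d \<noteq> w (a + b - i) d" using m by (auto simp: moved_def)
    have e: "Suc (a + b - Suc i) = a + b - i" using i by simp
    show ?thesis unfolding moved_def
      by (rule exI[of _ "a + b - Suc i"], unfold e) (use i in auto)
  qed
  then show ?thesis using * by blast
qed

lemma move_count_ge_card:
  assumes "finite S" "hanoi_path S P w a b" "\<forall>d\<in>S. moved w a b d"
  shows "card S \<le> move_count S w a b"
proof -
  obtain g where g: "\<forall>d\<in>S. a \<le> g d \<and> g d < b \<and> w (Suc (g d)) d \<noteq> w (g d) d"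
    using bchoice[OF assms(3)[unfolded moved_def]] by blast
  have "inj_on g S"
  proof (rule inj_onI, rule ccontr)
    fix d d' assume d: "d \<in> S" "d' \<in> S" "g d = g d'" "d \<noteq> d'"
    have "w (Suc (g d)) d' = w (g d) d'" using hanoi_path_others[OF assms(2), of "g d" d d'] bspec[OF g d(1)] d by blast
    then show False using bspec[OF g d(2)] d(3) by simp
  qed
  then have "card S = card (g ` S)" by (simp add: card_image)
  also have "\<dots> \<le> move_count S w a b" unfolding move_count_def using g by (intro card_mono) auto
  finally show ?thesis .
qed

section \<open>Blocking a peg and splitting a path\<close>

text \<open>While \<open>f\<close> rests, no larger disk can enter or leave its peg; one that is
  ever there would stay for the whole interval, contrary to \<open>moved\<close>.\<close>

lemma hanoi_path_blocked:
  assumes h: "hanoi_path S P w a b" and f: "f \<in> S" "\<not> moved w a b f"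
    and D: "D \<subseteq> S" "\<And>d. d \<in> D \<Longrightarrow> f < d" "\<And>d. d \<in> D \<Longrightarrow> moved w a b d"
  shows "hanoi_path D (P - {w a f}) w a b"
proof -
  define z where "z = w a f"
  have fz: "w k f = z" if "a \<le> k" "k \<le> b" for k
    using not_moved_const[OF f(2) that] z_def by simp
  have nz: "w i d \<noteq> z" if d: "d \<in> D" and i: "a \<le> i" "i \<le> b" for i d
  proof
    assume iz: "w i d = z"
    have dS: "d \<in> S" "f < d" using d D by auto
    have stay: "w (Suc k) d = z \<longleftrightarrow> w k d = z" if k: "a \<le> k" "k < b" for k
    proof (cases "w (Suc k) d = w k d")
      case False
      then show ?thesis using hanoi_path_smaller[OF h k dS(1) f(1) dS(2)] fz[of k] k by auto
    qed auto
    have all: "w k d = z \<longleftrightarrow> w a d = z" if "a \<le> k" "k \<le> b" for k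
      using that
    proof (induction k rule: dec_induct)
      case (step n) then show ?case using stay[of n] by auto
    qed auto
    have "w k d = z" if "a \<le> k" "k \<le> b" for k
      using all[OF that] all[OF i] iz by simp
    then have "\<not> moved w a b d" by (auto simp: moved_def)
    then show False using D(3) d by blast
  qed
  have hD: "hanoi_path D P w a b" using hanoi_path_mono[OF h D(1)] hanoi_path_le[OF h] by simp
  show ?thesis using hD nz unfolding hanoi_path_def z_def by auto
qed

lemma moved_split: "moved w a b d \<Longrightarrow> moved w a s d \<or> moved w s b d"
  unfolding moved_def by (meson leI)

text \<open>The dichotomy that drives the induction on the number of pegs: \<open>split\<close>
  keeps all pegs but yields two consecutive time intervals, \<open>block\<close> yields one peg
  fewer.\<close>

lemma split_or_block:
  assumes h: "hanoi_path S P w a b" and fin: "finite S" and mvd: "\<forall>d\<in>S. moved w a b d"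
    and K: "1 \<le> K" "K \<le> card S"
  obtains
    (split) s S1 S2 where "a \<le> s" "s \<le> b" "S1 \<subseteq> S" "S2 \<subseteq> S" "card S - K \<le> card S1" "card S - K \<le> card S2"
      "\<forall>d\<in>S1. moved w a s d" "\<forall>d\<in>S2. moved w s b d"
  | (block) a' b' D z where "a \<le> a'" "a' \<le> b'" "b' \<le> b" "D \<subseteq> S" "K \<le> card D" "z \<in> P"
      "hanoi_path D (P - {z}) w a' b'" "\<forall>d\<in>D. moved w a' b' d"
proof -
  define F where "F s = {d \<in> S. \<not> moved w a s d}" for s
  define L where "L s = {d \<in> S. \<not> moved w s b d}" for s
  have ab: "a \<le> b" by (rule hanoi_path_le[OF h])
  have finF: "finite (F s)" "finite (L s)" for s using fin by (auto simp: F_def L_def)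
  have Fa: "F a = S" by (auto simp: F_def moved_def)
  have Fb: "F b = {}" using mvd by (auto simp: F_def)
  \<comment> \<open>Only one disk moves per step, so the size of \<open>F\<close> drops by at most
    one at a time and passes through \<open>K\<close> on its way from \<open>card S\<close> to
    0.\<close>
  have Fstep: "card (F i) \<le> Suc (card (F (Suc i)))" if i: "a \<le> i" "i < b" for i
  proof -
    have sub: "F i - F (Suc i) \<subseteq> {d \<in> S. w (Suc i) d \<noteq> w i d}"
      by (auto simp: F_def moved_def less_Suc_eq)
    have "card (F i - F (Suc i)) \<le> 1"
    proof (rule ccontr)
      assume "\<not> ?thesis"
      then have "1 < card (F i - F (Suc i))" by simp
      then obtain d d' where dd: "d \<in> F i - F (Suc i)" "d' \<in> F i - F (Suc i)" "d \<noteq> d'"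
        by (metis One_nat_def card_le_Suc0_iff_eq finF(1) finite_Diff linorder_not_less)
      then show False using hanoi_path_others[OF h i, of d d'] sub by auto
    qed
    moreover have "card (F i) \<le> card (F (Suc i)) + card (F i - F (Suc i))"
      by (metis card_Un_le card_mono finF(1) finite_Diff finite_UnI Un_Diff_cancel Un_upper2 order_trans)
    ultimately show ?thesis by simp
  qed
  obtain s where s: "a \<le> s" "s \<le> b" "card (F s) = K"
  proof (cases "card S = K")
    case True then show ?thesis using that[of a] Fa ab by simp
  next
    case False
    then have "K < card (F a)" "\<not> K < card (F b)" using K Fa Fb by auto
    from first_exit[of a b "\<lambda>i. K < card (F i)", OF ab this]
    obtain i where i: "a \<le> i" "i < b" "K < card (F i)" "\<not> K < card (F (Suc i))"
      by (metis order_refl)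
    then have "card (F (Suc i)) = K" using Fstep[of i] by linarith
    then show ?thesis using that[of "Suc i"] i by simp
  qed
  have FL: "F s \<inter> L s = {}" using mvd moved_split[of w a b _ s] by (auto simp: F_def L_def)
  show thesis
  proof (cases "card (L s) \<le> K")
    case True
    show thesis
    proof (rule split[of s "S - F s" "S - L s"])
      show "card S - K \<le> card (S - F s)"
        using diff_card_le_card_Diff[OF finF(1), of S s] s by simp
      show "card S - K \<le> card (S - L s)"
        using diff_card_le_card_Diff[OF finF(2), of S s] True by linarith
    qed (use s in \<open>auto simp: F_def L_def\<close>)
  next
    case False
    \<comment> \<open>Here \<open>1 \<le> K\<close> enters: it gives \<open>F s\<close> a smallest
      disk. The two minima differ because \<open>F s\<close> and \<open>L s\<close> are
      disjoint.\<close>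
    have ne: "F s \<noteq> {}" "L s \<noteq> {}" using s K False by auto
    define f where "f = Min (F s)"
    define l where "l = Min (L s)"
    have f: "f \<in> F s" "\<And>d. d \<in> F s \<Longrightarrow> f \<le> d" using ne finF by (auto simp: f_def)
    have l: "l \<in> L s" "\<And>d. d \<in> L s \<Longrightarrow> l \<le> d" using ne finF by (auto simp: l_def)
    have "f \<noteq> l" using f(1) l(1) FL by auto
    then consider "f < l" | "l < f" by linarith
    then show thesis
    proof cases
      \<comment> \<open>\<open>f\<close> rests up to \<open>s\<close>, whereas each disk of
        \<open>L s\<close> is larger than \<open>f\<close> and moves before \<open>s\<close>, since
        it does not move afterwards.\<close>
      case 1
      have h1: "hanoi_path S P w a s" using hanoi_path_mono[OF h] s by simp
      have m: "moved w a s d" if "d \<in> L s" for d using that FL by (auto simp: F_def L_def)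
      show thesis
      proof (rule block[of a s "L s" "w a f"])
        show "hanoi_path (L s) (P - {w a f}) w a s"
        proof (rule hanoi_path_blocked[OF h1])
          show "f < d" if "d \<in> L s" for d using l(2)[OF that] 1 by simp
        qed (use f m in \<open>auto simp: F_def L_def\<close>)
        show "w a f \<in> P" using hanoi_path_in[OF h, of a f] f ab by (auto simp: F_def)
        show "\<forall>d\<in>L s. moved w a s d" using m by blast
      qed (use s False in \<open>auto simp: L_def\<close>)
    next
      case 2
      have h1: "hanoi_path S P w s b" using hanoi_path_mono[OF h] s by simp
      have m: "moved w s b d" if "d \<in> F s" for d using that FL by (auto simp: F_def L_def)
      show thesis
      proof (rule block[of s b "F s" "w s l"])
        show "hanoi_path (F s) (P - {w s l}) w s b"
        proof (rule hanoi_path_blocked[OF h1])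
          show "l < d" if "d \<in> F s" for d using f(2)[OF that] 2 by simp
        qed (use l m in \<open>auto simp: F_def L_def\<close>)
        show "w s l \<in> P" using hanoi_path_in[OF h, of s l] l s by (auto simp: L_def)
        show "\<forall>d\<in>F s. moved w s b d" using m by blast
      qed (use s in \<open>auto simp: F_def\<close>)
    qed
  qed
qed

subsection \<open>Four pegs\<close>

lemma off_when_moving:
  assumes "hanoi_path S P w a b" "a \<le> i" "i < b" "D \<in> S" "w (Suc i) D \<noteq> w i D" "d \<in> S" "d < D"
  shows "w i d \<in> P - {w i D, w (Suc i) D}"
  using hanoi_path_smaller[OF assms(1-4,6,7,5)] hanoi_path_in[OF assms(1,2) _ assms(6)] assms(3) by auto

text \<open>The classical bound \<open>2 ^ n - 1\<close>. On three pegs a move of the largest disk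
  requires all smaller ones on the third peg; they form such a tower at its first departure from
  \<open>x\<close> and at its last arrival on \<open>y\<close>.\<close>

lemma three_pegs:
  assumes "finite S" "hanoi_path S P w a b" "card P = 3" "x \<noteq> y" "\<forall>d\<in>S. w a d = x" "\<forall>d\<in>S. w b d = y"
  shows "2 ^ card S \<le> Suc (move_count S w a b)"
  using assms
proof (induction S arbitrary: a b x y rule: finite_linorder_max_induct)
  case empty
  then show ?case by simp
next
  case (insert s S)
  note h = insert.prems(1)
  have ab: "a \<le> b" by (rule hanoi_path_le[OF h])
  have ends: "w a s = x" "w b s = y" and xy: "x \<in> P" "y \<in> P"
    using insert.prems hanoi_path_in[OF h, of a s] hanoi_path_in[OF h, of b s] ab by auto
  obtain T where T: "a \<le> T" "T < b" "\<And>k. a \<le> k \<Longrightarrow> k \<le> T \<Longrightarrow> w k s = x" "w (Suc T) s \<noteq> x"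
    using first_exit[of a b "\<lambda>i. w i s = x"] ab ends \<open>x \<noteq> y\<close> by metis
  obtain U where U: "a \<le> U" "U < b" "w U s \<noteq> y" "\<And>k. U < k \<Longrightarrow> k \<le> b \<Longrightarrow> w k s = y"
    using last_exit[of a b "\<lambda>i. w i s \<noteq> y"] ab ends \<open>x \<noteq> y\<close> by metis
  \<comment> \<open>The largest disk is on \<open>x\<close> up to \<open>T\<close> and on
    \<open>y\<close> after \<open>U\<close>, so the phases before \<open>T\<close> and after
    \<open>U\<close> do not overlap; \<open>T = U\<close> is possible.\<close>
  have TU: "T \<le> U"
  proof (rule ccontr)
    assume "\<not> T \<le> U"
    then show False using U(4)[of T] T(3)[of T] T(1,2) \<open>x \<noteq> y\<close> by auto
  qed
  have single: "\<exists>q. q \<noteq> w i s \<and> q \<noteq> w (Suc i) s \<and> (\<forall>d\<in>S. w i d = q)"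
    if i: "a \<le> i" "i < b" "w (Suc i) s \<noteq> w i s" for i
  proof -
    have "w i s \<in> P" "w (Suc i) s \<in> P" using hanoi_path_in[OF h] i by auto
    then have "card (P - {w i s, w (Suc i) s}) = 1"
      using \<open>card P = 3\<close> i(3) by (subst card_Diff_subset) auto
    then obtain q where q: "P - {w i s, w (Suc i) s} = {q}" using card_1_singletonE by blast
    have "w i d \<in> P - {w i s, w (Suc i) s}" if "d \<in> S" for d
      using off_when_moving[OF h i(1,2) _ i(3), of d] that insert.hyps(2) by auto
    then show ?thesis using q by blast
  qed
  obtain q where q: "q \<noteq> x" "\<forall>d\<in>S. w T d = q" using single[of T] T by auto
  have wU: "w (Suc U) s = y" using U by simp
  then obtain q' where q': "q' \<noteq> y" "\<forall>d\<in>S. w U d = q'" using single[of U] U by auto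
  have sub: "S \<subseteq> insert s S" by auto
  have 1: "2 ^ card S \<le> Suc (move_count S w a T)"
  proof (rule insert.IH[of a T x q])
    show "hanoi_path S P w a T" using hanoi_path_mono[OF h sub] T by simp
  qed (use insert.prems q in auto)
  have 2: "2 ^ card S \<le> Suc (move_count S w U b)"
  proof (rule insert.IH[of U b q' y])
    show "hanoi_path S P w U b" using hanoi_path_mono[OF h sub] U by simp
  qed (use insert.prems q' in auto)
  have hU: "hanoi_path (insert s S) P w U b" using hanoi_path_mono[OF h] U by simp
  have 3: "move_count S w U b + move_count {s} w U b \<le> move_count (insert s S) w U b"
    by (rule move_count_disjoint[OF hU]) (use insert.hyps in auto)
  have 4: "1 \<le> move_count {s} w U b" using U wU by (intro move_count_step[of s _ U U]) auto
  have 5: "move_count (insert s S) w a b = move_count (insert s S) w a T + move_count (insert s S) w T b"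
    using T by (intro move_count_split) auto
  have 6: "move_count (insert s S) w U b \<le> move_count (insert s S) w T b" using TU by (intro move_count_subinterval) auto
  have 7: "move_count S w a T \<le> move_count (insert s S) w a T" by (intro move_count_mono) auto
  have "card (insert s S) = Suc (card S)" using insert.hyps by (intro card_insert_disjoint) auto
  then show ?case using 1 2 3 4 5 6 7 by simp
qed

section \<open>Weights and Bousch's function\<close>

text \<open>These numbers bound the levels on which the four-peg Frame-Stewart numbers grow by a
  constant power of two.\<close>

definition tri :: "nat \<Rightarrow> nat" where "tri k = \<Sum>{..k}"

lemma tri_0 [simp]: "tri 0 = 0" by (simp add: tri_def)

lemma tri_Suc: "tri (Suc k) = tri k + Suc k" by (simp add: tri_def)

lemma tri_mono: "k \<le> l \<Longrightarrow> tri k \<le> tri l"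
  unfolding tri_def by (intro sum_mono2) auto

text \<open>
  With \<open>tri k \<le> n < tri (k + 1)\<close> the weight of \<open>n\<close> is \<open>2 ^ min k L\<close>; the recursive form
  expresses it without the level \<open>k\<close> of \<open>n\<close>.
\<close>

fun weight :: "nat \<Rightarrow> nat \<Rightarrow> int" where
  "weight 0 n = 1"
| "weight (Suc k) n = weight k n + (if tri (Suc k) \<le> n then 2 ^ k else 0)"

text \<open>The Frame-Stewart number of moves for \<open>tri L\<close> disks on four pegs, in other
  words the sum of \<open>(k + 1) * 2 ^ k\<close> over \<open>k < L\<close>.\<close>

definition offset :: "nat \<Rightarrow> int" where "offset L = (int L - 1) * 2 ^ L + 1"

text \<open>Bousch's function, with one lower bound for each cap \<open>L\<close>; the induction
  step combines bounds for different caps.\<close>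

definition psi :: "nat \<Rightarrow> nat set \<Rightarrow> int" where
  "psi L E = sum (weight L) E - offset L"

lemma offset_Suc: "offset (Suc k) = offset k + int (Suc k) * 2 ^ k"
  by (simp add: offset_def algebra_simps)

lemma offset_double: "offset (Suc k) = 2 * offset k + 2 * 2 ^ k - 1"
  by (simp add: offset_def algebra_simps)

lemma offset_nonneg: "0 \<le> offset L"
  by (induction L) (simp_all add: offset_Suc, simp add: offset_def)

lemma weight_pos: "0 < weight k n"
  by (induction k) (auto simp: add_pos_nonneg)

lemma weight_high: "tri k \<le> n \<Longrightarrow> weight k n = 2 ^ k"
proof (induction k)
  case (Suc k)
  then show ?case using tri_mono[of k "Suc k"] by simp
qed simp

lemma weight_le: "weight k n \<le> 2 ^ k"
proof (induction k)
  case (Suc k)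
  have "weight (Suc k) n \<le> weight k n + 2 ^ k" by simp
  also have "\<dots> \<le> 2 ^ Suc k" using Suc by simp
  finally show ?case .
qed simp

text \<open>Below \<open>tri (Suc k)\<close> the cap has no effect, and the block from
  \<open>tri j\<close> to \<open>tri (Suc j) - 1\<close> consists of \<open>j + 1\<close> disks of
  weight \<open>2 ^ j\<close>.\<close>

lemma sum_weight_tri: "sum (weight k) {..<tri (Suc k)} = offset (Suc k)"
proof (induction k)
  case 0
  then show ?case by (simp add: offset_def tri_Suc)
next
  case (Suc k)
  have eq: "{..<tri (Suc (Suc k))} = {..<tri (Suc k)} \<union> {tri (Suc k)..<tri (Suc (Suc k))}"
    by (auto simp: tri_Suc)
  have "sum (weight (Suc k)) {..<tri (Suc (Suc k))} =
      sum (weight (Suc k)) {..<tri (Suc k)} + sum (weight (Suc k)) {tri (Suc k)..<tri (Suc (Suc k))}"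
    unfolding eq by (rule sum.union_disjoint) auto
  also have "sum (weight (Suc k)) {..<tri (Suc k)} = sum (weight k) {..<tri (Suc k)}"
    by (intro sum.cong) auto
  also have "sum (weight (Suc k)) {tri (Suc k)..<tri (Suc (Suc k))} = (\<Sum>i\<in>{tri (Suc k)..<tri (Suc (Suc k))}. 2 ^ Suc k)"
    by (intro sum.cong refl weight_high) auto
  finally show ?case using Suc by (simp add: offset_Suc[of "Suc k"] tri_Suc)
qed

lemma sum_weight_mono: "finite B \<Longrightarrow> A \<subseteq> B \<Longrightarrow> sum (weight k) A \<le> sum (weight k) B"
  using weight_pos by (intro sum_mono2) (auto simp: less_imp_le)

text \<open>Raising the cap doubles the weight \<open>2 ^ k\<close> of the disks from
  \<open>tri (Suc k)\<close> on and changes no other weight.\<close>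

lemma sum_weight_Suc:
  assumes "finite E"
  shows "sum (weight (Suc k)) E = sum (weight k) E + int (card {n\<in>E. tri (Suc k) \<le> n}) * 2 ^ k"
proof -
  have "(\<Sum>n\<in>E. if tri (Suc k) \<le> n then 2 ^ k else 0 :: int) = (\<Sum>n\<in>{n\<in>E. tri (Suc k) \<le> n}. 2 ^ k)"
    using assms by (subst sum.inter_filter) auto
  then show ?thesis by (simp add: sum.distrib )
qed

lemma sum_weight_high:
  assumes "\<forall>n\<in>A. tri k \<le> n"
  shows "sum (weight k) A = int (card A) * 2 ^ k"
proof -
  have "sum (weight k) A = (\<Sum>n\<in>A. 2 ^ k)" using assms by (intro sum.cong) (auto simp: weight_high)
  then show ?thesis by simp
qed


section \<open>Bousch's inequality for emptying a peg\<close>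

text \<open>
  Here \<open>E\<close> need not contain all disks of peg \<open>x\<close>, and the other disks are placed arbitrarily: large
  disks in \<open>E\<close> alone already force many moves.
\<close>

definition tower_bound :: "nat set \<Rightarrow> nat \<Rightarrow> bool" where
  "tower_bound P N \<longleftrightarrow> (\<forall>w a b x y E L. hanoi_path {..<N} P w a b \<longrightarrow> x \<in> P \<longrightarrow> y \<in> P \<longrightarrow> x \<noteq> y \<longrightarrow>
     E \<subseteq> {..<N} \<longrightarrow> (\<forall>d\<in>E. w a d = x) \<longrightarrow> (\<forall>d<N. w b d \<noteq> x \<and> w b d \<noteq> y) \<longrightarrow>
     psi L E \<le> int (move_count {..<N} w a b))"

lemma tower_boundD:
  assumes "tower_bound P N" "hanoi_path {..<N} P w a b" "x \<in> P" "y \<in> P" "x \<noteq> y" "E \<subseteq> {..<N}"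
    "\<And>d. d \<in> E \<Longrightarrow> w a d = x" "\<And>d. d < N \<Longrightarrow> w b d \<noteq> x" "\<And>d. d < N \<Longrightarrow> w b d \<noteq> y"
  shows "psi L E \<le> int (move_count {..<N} w a b)"
  using assms unfolding tower_bound_def by blast

text \<open>When \<open>j\<close> moves, both its pegs are free of smaller disks. This is exactly
  the final condition in \<open>tower_bound P j\<close>, with \<open>y\<close> as the other peg of
  the move.\<close>

lemma bound_before:
  assumes j: "tower_bound P j" and h: "hanoi_path {..<N} P w a b" "j < N"
    and i: "a \<le> i" "i < b" "w (Suc i) j \<noteq> w i j"
    and E: "E \<subseteq> {..<j}" "\<And>d. d \<in> E \<Longrightarrow> w a d = x" and x: "x = w i j \<or> x = w (Suc i) j"
  shows "psi L E \<le> int (move_count {..<j} w a i)"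
proof -
  define y where "y = (if x = w i j then w (Suc i) j else w i j)"
  have xy: "{w i j, w (Suc i) j} = {x, y}" "x \<noteq> y" using x i by (auto simp: y_def)
  have P: "w i j \<in> P" "w (Suc i) j \<in> P" using hanoi_path_in[OF h(1)] h(2) i by auto
  show ?thesis
  proof (rule tower_boundD[OF j, where x = x and y = y])
    show "hanoi_path {..<j} P w a i" using hanoi_path_mono[OF h(1)] i h(2) by simp
    have "w i d \<in> P - {w i j, w (Suc i) j}" if "d < j" for d
      using off_when_moving[OF h(1) i(1,2) _ i(3)] h(2) that by simp
    then show "w i d \<noteq> x" "w i d \<noteq> y" if "d < j" for d unfolding xy using that by auto
    show "x \<in> P" "y \<in> P" using P x by (auto simp: y_def)
  qed (use E xy in auto)
qed

text \<open>The time reversal of \<open>bound_before\<close>: what stands on a peg of the move at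
  time \<open>t\<close> has been gathered there after the move.\<close>

lemma bound_after:
  assumes j: "tower_bound P j" and h: "hanoi_path {..<N} P w a b" "j < N"
    and i: "a \<le> i" "i \<le> t" "i < b" "t \<le> b" "w (Suc i) j \<noteq> w i j"
    and E: "E \<subseteq> {..<j}" "\<And>d. d \<in> E \<Longrightarrow> w t d = x" and x: "x = w i j \<or> x = w (Suc i) j"
  shows "psi L E \<le> int (move_count {..<j} w i t)"
proof -
  define y where "y = (if x = w i j then w (Suc i) j else w i j)"
  have xy: "{w i j, w (Suc i) j} = {x, y}" "x \<noteq> y" using x i by (auto simp: y_def)
  have P: "w i j \<in> P" "w (Suc i) j \<in> P" using hanoi_path_in[OF h(1)] h(2) i by auto
  define v where "v k = w (i + t - k)" for k
  have "psi L E \<le> int (move_count {..<j} v i t)"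
  proof (rule tower_boundD[OF j, where x = x and y = y])
    have "hanoi_path {..<j} P w i t" using hanoi_path_mono[OF h(1)] i h(2) by simp
    then show "hanoi_path {..<j} P v i t" unfolding v_def by (rule hanoi_path_rev)
    have "w i d \<in> P - {w i j, w (Suc i) j}" if "d < j" for d
      using off_when_moving[OF h(1) i(1,3) _ i(5)] h(2) that by simp
    then show "v t d \<noteq> x" "v t d \<noteq> y" if "d < j" for d unfolding xy using that by (auto simp: v_def)
    show "x \<in> P" "y \<in> P" using P x by (auto simp: y_def)
  qed (use E xy in \<open>auto simp: v_def\<close>)
  then show ?thesis using move_count_rev[OF i(2), of "{..<j}" w] unfolding v_def by simp
qed

text \<open>\<open>d\<close> cannot leave its peg while the smaller disk \<open>f\<close> lies
  there.\<close>

lemma stack_stays: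
  assumes h: "hanoi_path S P w a b" and d: "f \<in> S" "d \<in> S" "f < d"
    and f: "\<And>k. a \<le> k \<Longrightarrow> k \<le> b \<Longrightarrow> w k f = x" and "w a d = x"
  shows "w b d = x"
proof -
  have "w k d = x" if "a \<le> k" "k \<le> b" for k
    using that
  proof (induction k rule: dec_induct)
    case (step n)
    then show ?case
      using hanoi_path_smaller(1)[OF h, of n d f] d f[of n] by (cases "w (Suc n) d = w n d") auto
  qed (rule assms(6))
  then show ?thesis using hanoi_path_le[OF h] by simp
qed

text \<open>
  Let \<open>j\<close> be the largest disk of the tower that ends on \<open>z\<close>; the larger ones, \<open>R\<close>, end on \<open>g\<close>.
  Either the smallest disk of \<open>R\<close> leaves \<open>x\<close> before the last arrival of \<open>j\<close> on \<open>z\<close>, or from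
  then on \<open>j\<close> blocks \<open>z\<close> and \<open>R\<close> is transferred on three pegs.
\<close>

lemma two_stage:
  assumes bnd: "\<And>j. j < e \<Longrightarrow> tower_bound P j" and h: "hanoi_path {..<e} P w a t" and P: "card P = 4"
    and E: "E \<subseteq> {..<e}" "\<And>d. d \<in> E \<Longrightarrow> w a d = x" and j: "j \<in> E" "w t j = z"
    and F: "F \<subseteq> {..<j}" "\<And>d. d \<in> F \<Longrightarrow> w t d = z"
    and R: "R = {d \<in> E. j < d}" "\<And>d. d \<in> R \<Longrightarrow> w t d = g" and ne: "g \<noteq> x" "z \<noteq> x"
  shows "(\<forall>L L'. psi L (insert j {d \<in> E. d < j}) + psi L' F + 1 \<le> int (move_count {..<e} w a t)) \<or>
    (\<forall>L L'. psi L {d \<in> E. d < j} + psi L' F + 2 ^ card R \<le> int (move_count {..<e} w a t))"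
proof -
  have at: "a \<le> t" by (rule hanoi_path_le[OF h])
  have je: "j < e" "w a j = x" using j E by auto
  obtain i where i: "a \<le> i" "i < t" "\<And>k. a \<le> k \<Longrightarrow> k \<le> i \<Longrightarrow> w k j = x" "w (Suc i) j \<noteq> x"
    using first_exit[of a t "\<lambda>k. w k j = x"] at je j ne by metis
  obtain u where u: "a \<le> u" "u < t" "w u j \<noteq> z" "\<And>k. u < k \<Longrightarrow> k \<le> t \<Longrightarrow> w k j = z"
    using last_exit[of a t "\<lambda>k. w k j \<noteq> z"] at je j ne by metis
  have iu: "i \<le> u"
  proof (rule ccontr)
    assume "\<not> i \<le> u"
    then show False using u(4)[of i] i(3)[of i] i(1,2) ne by auto
  qed
  have uz: "w (Suc u) j = z" using u by simp
  \<comment> \<open>When \<open>j\<close> arrives on \<open>z\<close>, no smaller disk is there; all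
    of \<open>F\<close> comes later.\<close>
  have Fb: "psi L' F \<le> int (move_count {..<j} w u t)" for L'
    by (rule bound_after[OF bnd h, where x = z]) (use je u uz F in auto)
  have hu: "hanoi_path {..<e} P w u t" using hanoi_path_mono[OF h] u by simp
  have jstep: "1 \<le> move_count {j} w u t" using u uz by (intro move_count_step[of j _ u u]) auto
  have split: "move_count {..<e} w a t = move_count {..<e} w a u + move_count {..<e} w u t"
    using u by (intro move_count_split) auto
  have finR: "finite R" using R E finite_subset by fastforce
  \<comment> \<open>If \<open>R\<close> is still on \<open>x\<close> when \<open>j\<close> arrives,
    the \<open>2 ^ card R - 1\<close> moves of its three-peg transfer and the arrival of
    \<open>j\<close> make \<open>2 ^ card R\<close>.\<close>
  have second: ?thesis if early: "\<And>d. d \<in> R \<Longrightarrow> w (Suc u) d = x"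
  proof -
    have hS: "hanoi_path {..<e} P w (Suc u) t" using hanoi_path_mono[OF h] u by simp
    have nj: "\<not> moved w (Suc u) t j" using u by (auto simp: moved_def)
    have "hanoi_path R (P - {w (Suc u) j}) w (Suc u) t"
    proof (rule hanoi_path_blocked[OF hS])
      fix d assume d: "d \<in> R"
      show "moved w (Suc u) t d"
        using moved_change[of w "Suc u" d t "Suc u" t] early[OF d] R(2)[OF d] ne u by simp
    qed (use je nj R E in auto)
    moreover have "card (P - {w (Suc u) j}) = 3"
      using P hanoi_path_in[OF h, of "Suc u" j] u je by (subst card_Diff_singleton) auto
    ultimately have tp: "2 ^ card R \<le> Suc (move_count R w (Suc u) t)"
      using three_pegs[OF finR, of "P - {w (Suc u) j}" w "Suc u" t x g] early R(2) ne by blast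
    have 1: "move_count R w (Suc u) t \<le> move_count R w u t" by (intro move_count_subinterval) auto
    have 2: "move_count {j} w u t + move_count R w u t \<le> move_count ({j} \<union> R) w u t"
      by (rule move_count_disjoint[OF hanoi_path_mono[OF hu]]) (use R je E u in auto)
    have 3: "move_count {..<j} w u t + move_count ({j} \<union> R) w u t \<le> move_count {..<e} w u t"
      by (rule move_count_disjoint[OF hu]) (use R je E in auto)
    have 4: "psi L {d \<in> E. d < j} \<le> int (move_count {..<j} w a i)" for L
      by (rule bound_before[OF bnd h, where x = x]) (use i je E in auto)
    have 5: "move_count {..<j} w a i \<le> move_count {..<j} w a u" using iu by (intro move_count_subinterval) auto
    have 6: "move_count {..<j} w a u \<le> move_count {..<e} w a u" using je by (intro move_count_mono) auto
    have 7: "move_count {..<j} w a i + move_count {..<j} w u t + 2 ^ card R \<le> move_count {..<e} w a t"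
      using tp 1 2 3 5 6 split jstep by linarith
    have "psi L {d \<in> E. d < j} + psi L' F + 2 ^ card R \<le> int (move_count {..<e} w a t)" for L L'
    proof -
      have "int (move_count {..<j} w a i + move_count {..<j} w u t + 2 ^ card R) \<le> int (move_count {..<e} w a t)"
        using 7 by (simp only: of_nat_le_iff)
      then show ?thesis using 4[of L] Fb[of L'] by simp
    qed
    then show ?thesis by blast
  qed
  show ?thesis
  proof (cases "R = {}")
    case True
    then show ?thesis using second by blast
  next
    case False
    define p where "p = Min R"
    have p: "p \<in> R" "\<And>d. d \<in> R \<Longrightarrow> p \<le> d" using False finR by (auto simp: p_def)
    have pE: "p \<in> E" "j < p" "p < e" "w a p = x" "w t p = g" using p(1) R E by auto
    obtain q where q: "a \<le> q" "q < t" "\<And>k. a \<le> k \<Longrightarrow> k \<le> q \<Longrightarrow> w k p = x" "w (Suc q) p \<noteq> x"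
      using first_exit[of a t "\<lambda>k. w k p = x"] at pE ne by metis
    show ?thesis
    proof (cases "q \<le> u")
      \<comment> \<open>\<open>p\<close> leaves \<open>x\<close> before \<open>j\<close> arrives on
        \<open>z\<close>, and by then everything smaller than \<open>p\<close>, including
        \<open>j\<close>, must be off \<open>x\<close>. The summand 1 is the arrival of
        \<open>j\<close>.\<close>
      case True
      have eq: "insert j {d \<in> E. d < j} = {d \<in> E. d < p}"
      proof (intro equalityI subsetI)
        fix d assume d: "d \<in> {d \<in> E. d < p}"
        then have "\<not> j < d" using p(2)[of d] R by auto
        then show "d \<in> insert j {d \<in> E. d < j}" using d by auto
      qed (use pE j(1) in auto)
      have 1: "psi L {d \<in> E. d < p} \<le> int (move_count {..<p} w a q)" for L
        by (rule bound_before[OF bnd h, where x = x]) (use q pE E in auto)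
      have 2: "move_count {..<p} w a q \<le> move_count {..<p} w a u" using True by (intro move_count_subinterval) auto
      have 3: "move_count {..<p} w a u \<le> move_count {..<e} w a u" using pE by (intro move_count_mono) auto
      have 4: "move_count {..<j} w u t + move_count {j} w u t \<le> move_count {..<e} w u t"
        by (rule move_count_disjoint[OF hu]) (use je in auto)
      have "psi L (insert j {d \<in> E. d < j}) + psi L' F + 1 \<le> int (move_count {..<e} w a t)" for L L'
        unfolding eq using 1[of L] Fb[of L'] 2 3 4 jstep split by linarith
      then show ?thesis by blast
    next
      case False
      show ?thesis
      proof (rule second)
        fix d assume d: "d \<in> R"
        have dE: "d \<in> E" "d < e" "w a d = x" using d R E by auto
        show "w (Suc u) d = x"
        proof (cases "d = p")
          case True
          then show ?thesis using q(3)[of "Suc u"] False u by simp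
        next
          \<comment> \<open>The smaller disk \<open>p\<close> stays on \<open>x\<close> beyond
            \<open>u\<close> and pins \<open>d\<close>.\<close>
          case dp: False
          have hq: "hanoi_path {..<e} P w a (Suc u)" using hanoi_path_mono[OF h] u by simp
          show ?thesis
            by (rule stack_stays[OF hq, of p d x]) (use pE dE p(2)[OF d] dp q(3) False in auto)
        qed
      qed
    qed
  qed
qed

text \<open>
  After its last departure from \<open>x\<close> the disk \<open>e\<close> goes either to a peg other than \<open>y\<close>, and then the
  disks resting on \<open>g = y\<close> have to leave it; or to \<open>y\<close>, and then those on the next peg \<open>g\<close> of \<open>e\<close>
  have to leave before \<open>e\<close> moves on.
\<close>

lemma last_departure:
  assumes bnd: "tower_bound P e" and h: "hanoi_path {..<Suc e} P w a b" and P: "card P = 4"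
    and xy: "x \<in> P" "y \<in> P" "x \<noteq> y" and e: "w a e = x" and b: "\<And>d. d \<le> e \<Longrightarrow> w b d \<noteq> x \<and> w b d \<noteq> y"
  obtains t g z where "a \<le> t" "t < b" "w t e = x" "w (Suc t) e \<noteq> x" "g \<noteq> x" "z \<noteq> x" "g \<noteq> z"
    "\<And>d. d < e \<Longrightarrow> w t d = g \<or> w t d = z"
    "\<And>L. psi L {d. d < e \<and> w t d = g} \<le> int (move_count {..<e} w t b)"
proof -
  have ab: "a \<le> b" by (rule hanoi_path_le[OF h])
  have "w b e \<noteq> x" using b by blast
  then obtain t where t: "a \<le> t" "t < b" "w t e = x" "\<And>k. t < k \<Longrightarrow> k \<le> b \<Longrightarrow> w k e \<noteq> x"
    using last_exit[of a b "\<lambda>i. w i e = x"] ab e by metis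
  define c where "c = w (Suc t) e"
  have c: "c \<noteq> x" "c \<in> P" using t hanoi_path_in[OF h, of "Suc t" e] by (auto simp: c_def)
  have off: "w t d \<in> P - {x, c}" if "d < e" for d
    using off_when_moving[OF h t(1,2), of e d] that t c unfolding c_def by auto
  have ht: "hanoi_path {..<e} P w t b" using hanoi_path_mono[OF h] t by simp
  show thesis
  proof (cases "c = y")
    case False
    then have "card (P - {x, c, y}) = 1" using P xy c by (subst card_Diff_subset) auto
    then obtain z where z: "P - {x, c, y} = {z}" using card_1_singletonE by blast
    then have z': "z \<noteq> x" "y \<noteq> z" by auto
    show thesis
    proof (rule that[of t y z])
      show "w t d = y \<or> w t d = z" if "d < e" for d using off[OF that] z by blast
      show "psi L {d. d < e \<and> w t d = y} \<le> int (move_count {..<e} w t b)" for L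
        by (rule tower_boundD[OF bnd ht, of y x]) (use xy b in auto)
    qed (use t c xy z' in \<open>auto simp: c_def\<close>)
  next
    case True
    have "\<not> w b e = y" using b by blast
    then obtain s where s: "Suc t \<le> s" "s < b" "\<And>k. Suc t \<le> k \<Longrightarrow> k \<le> s \<Longrightarrow> w k e = y" "w (Suc s) e \<noteq> y"
      using first_exit[of "Suc t" b "\<lambda>i. w i e = y"] t True c_def by (metis Suc_leI)
    define g where "g = w (Suc s) e"
    \<comment> \<open>\<open>e\<close> does not return to \<open>x\<close> after \<open>t\<close>,
      so \<open>g\<close> differs from \<open>x\<close>; one further peg \<open>z\<close> remains
      besides \<open>x\<close>, \<open>y\<close> and \<open>g\<close>.\<close>
    have g: "g \<noteq> x" "g \<noteq> y" "g \<in> P" using s t(4)[of "Suc s"] t(1) hanoi_path_in[OF h, of "Suc s" e] by (auto simp: g_def)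
    then have "card (P - {x, y, g}) = 1" using P xy by (subst card_Diff_subset) auto
    then obtain z where z: "P - {x, y, g} = {z}" using card_1_singletonE by blast
    then have z': "z \<noteq> x" "g \<noteq> z" by auto
    have off': "w s d \<in> P - {y, g}" if "d < e" for d
      using off_when_moving[OF h, of s e d] that s t unfolding g_def by auto
    show thesis
    proof (rule that[of t g z])
      show "w t d = g \<or> w t d = z" if "d < e" for d using off[OF that] z True by blast
      show "psi L {d. d < e \<and> w t d = g} \<le> int (move_count {..<e} w t b)" for L
      proof -
        have hs: "hanoi_path {..<e} P w t s" using hanoi_path_mono[OF ht] s by simp
        have "psi L {d. d < e \<and> w t d = g} \<le> int (move_count {..<e} w t s)"
          by (rule tower_boundD[OF bnd hs, of g y]) (use xy g off' in auto)
        also have "\<dots> \<le> int (move_count {..<e} w t b)" using s move_count_subinterval[of t t s b] by simp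
        finally show ?thesis .
      qed
    qed (use t c g z' in \<open>auto simp: c_def\<close>)
  qed
qed

text \<open>Let \<open>t\<close> be the last departure of the largest disk \<open>e\<close> from
  \<open>x\<close>. The moves of the smaller disks before \<open>t\<close> (\<open>A\<close>) and
  after it (\<open>B\<close>) are bounded separately. An inner induction on \<open>L\<close> raises
  the cap and weighs the gain of the disks in \<open>C\<close> against the growth of
  \<open>offset\<close>.\<close>

lemma tower_bound_step:
  assumes bnd: "\<And>n. n < Suc e \<Longrightarrow> tower_bound P n" and P: "card P = 4"
  shows "tower_bound P (Suc e)"
  unfolding tower_bound_def
proof (intro allI impI)
  fix w a b x y E L
  assume h: "hanoi_path {..<Suc e} P w a b" and xy: "x \<in> P" "y \<in> P" "x \<noteq> y" and E: "E \<subseteq> {..<Suc e}"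
    and Ex: "\<forall>d\<in>E. w a d = x" and fin: "\<forall>d<Suc e. w b d \<noteq> x \<and> w b d \<noteq> y"
  have he: "hanoi_path {..<e} P w a b" using hanoi_path_mono[OF h] hanoi_path_le[OF h] by simp
  define M where "M = int (move_count {..<Suc e} w a b)"
  have "psi L E \<le> M"
  proof (cases "e \<in> E")
    case False
    then have "E \<subseteq> {..<e}" using E by (auto simp: less_Suc_eq)
    then have "psi L E \<le> int (move_count {..<e} w a b)"
      by (intro tower_boundD[OF bnd he xy]) (use Ex fin in auto)
    also have "\<dots> \<le> M" unfolding M_def using move_count_mono[of "{..<e}" "{..<Suc e}" w a b] by simp
    finally show ?thesis .
  next
    case eE: True
    have finE: "finite E" using E finite_subset by blast
    obtain t g z where t: "a \<le> t" "t < b" "w t e = x" "w (Suc t) e \<noteq> x"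
      and gz: "g \<noteq> x" "z \<noteq> x" "g \<noteq> z" "\<And>d. d < e \<Longrightarrow> w t d = g \<or> w t d = z"
      and Gt: "\<And>L. psi L {d. d < e \<and> w t d = g} \<le> int (move_count {..<e} w t b)"
      using last_departure[OF bnd h P xy, of thesis] eE Ex fin by auto
    define G where "G = {d. d < e \<and> w t d = g}"
    define A where "A = int (move_count {..<e} w a t)"
    define B where "B = int (move_count {..<e} w t b)"
    have G: "psi L G \<le> B" for L using Gt by (simp add: G_def B_def)
    have ht: "hanoi_path {..<e} P w a t" using hanoi_path_mono[OF he] t by simp
    \<comment> \<open>The extra move is the departure of \<open>e\<close> from
      \<open>x\<close>.\<close>
    have AB: "A + B + 1 \<le> M"
    proof -
      have ht': "hanoi_path {..<Suc e} P w t b" using hanoi_path_mono[OF h] t by simp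
      have "move_count {..<e} w t b + move_count {e} w t b \<le> move_count {..<Suc e} w t b"
        by (rule move_count_disjoint[OF ht']) auto
      moreover have "1 \<le> move_count {e} w t b" using t by (intro move_count_step[of e _ t t]) auto
      moreover have "move_count {..<e} w a t \<le> move_count {..<Suc e} w a t" by (intro move_count_mono) auto
      moreover have "move_count {..<Suc e} w a b = move_count {..<Suc e} w a t + move_count {..<Suc e} w t b"
        using t by (intro move_count_split) auto
      ultimately show ?thesis unfolding A_def B_def M_def by linarith
    qed
    define E' where "E' = E - {e}"
    have E': "psi L E' \<le> A" for L
      unfolding A_def
      by (rule bound_before[OF bnd h, where x = x]) (use t E Ex in \<open>auto simp: E'_def less_Suc_eq\<close>)
    have I: "psi L E' + psi L' G + 1 \<le> M" for L L' using E'[of L] G[of L'] AB by linarith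
    have WE': "sum (weight k) E' = sum (weight k) E - weight k e" for k
      unfolding E'_def using finE eE by (simp add: sum_diff1)
    have finG: "finite G" by (auto simp: G_def)
    show ?thesis
    proof (induction L)
      case 0
      have "0 \<le> sum (weight 0) G" by (intro sum_nonneg) auto
      then show ?case using I[of 0 0] WE'[of 0] by (simp add: psi_def offset_def)
    next
      case (Suc k)
      define C where "C = {n\<in>E. tri (Suc k) \<le> n}"
      define X where "X = (2::int) ^ k"
      have X: "1 \<le> X" by (simp add: X_def)
      have offset: "offset (Suc k) = 2 * offset k + 2 * X - 1" "offset (Suc k) = offset k + (int k + 1) * X"
        by (simp add: offset_double X_def) (simp add: offset_Suc X_def algebra_simps)
      have finC: "finite C" using finE by (simp add: C_def)
      have goal: "psi (Suc k) E = psi k E + int (card C) * X + offset k - offset (Suc k)"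
        unfolding psi_def sum_weight_Suc[OF finE] C_def X_def by simp
      show ?case
      \<comment> \<open>Raising the cap adds \<open>card C * 2 ^ k\<close> to the weights and
        \<open>(k + 1) * 2 ^ k\<close> to \<open>offset\<close>, so for
        \<open>card C \<le> k\<close> the bound at cap \<open>k\<close> suffices.\<close>
      proof (cases "card C < Suc k")
        case True
        then have "int (card C) * X \<le> (int k + 1) * X" using X by (intro mult_right_mono) auto
        then show ?thesis using Suc goal offset(2) by simp
      next
        case False
        then have "C \<noteq> {}" by auto
        then have etri: "tri (Suc k) \<le> e" using E by (auto simp: C_def)
        then have eC: "e \<in> C" using eE by (simp add: C_def)
        have we: "weight k e = X" "weight (Suc k) e = 2 * X"
          using etri tri_mono[of k "Suc k"] weight_high[of k e] weight_high[of "Suc k" e] by (auto simp: X_def)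
        show ?thesis
        proof (cases "\<exists>j\<in>C. j \<noteq> e \<and> w t j = z")
          \<comment> \<open>All disks of \<open>C\<close> except \<open>e\<close> stand on
            \<open>g\<close> at \<open>t\<close>. They are counted a second time in
            \<open>psi k G\<close>, which is just the increase needed.\<close>
          case False
          have "C - {e} \<subseteq> G"
          proof
            fix d assume d: "d \<in> C - {e}"
            then have "d < e" using E by (auto simp: C_def less_Suc_eq)
            then show "d \<in> G" using d False gz(4)[of d] by (auto simp: G_def)
          qed
          then have "sum (weight k) (C - {e}) \<le> sum (weight k) G" using finG by (intro sum_weight_mono) auto
          moreover have "sum (weight k) (C - {e}) = int (card (C - {e})) * 2 ^ k"
            by (intro sum_weight_high) (auto simp: C_def intro: order_trans[OF tri_mono[of k "Suc k"]])
          moreover have "int (card (C - {e})) = int (card C) - 1"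
            using card.remove[OF finC eC] by simp
          ultimately have "int (card C) * X - X \<le> sum (weight k) G"
            by (simp add: X_def algebra_simps)
          then show ?thesis using I[of k k] WE'[of k] goal offset(1) we by (simp add: psi_def)
        next
          case True
          \<comment> \<open>With \<open>j\<close> the largest disk of \<open>C\<close> other than
            \<open>e\<close> on \<open>z\<close>, all disks of the tower between \<open>j\<close>
            and \<open>e\<close> are on \<open>g\<close>, and \<open>two_stage\<close>
            applies.\<close>
          define J where "J = {j\<in>C. j \<noteq> e \<and> w t j = z}"
          define j where "j = Max J"
          have J: "finite J" "J \<noteq> {}" using finC True by (auto simp: J_def)
          then have jJ: "j \<in> J" and jmax: "\<And>d. d \<in> J \<Longrightarrow> d \<le> j" by (auto simp: j_def)
          have j: "j \<in> E" "tri (Suc k) \<le> j" "j \<noteq> e" "w t j = z" using jJ by (auto simp: J_def C_def)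
          have je: "j < e" using j E by (auto simp: less_Suc_eq)
          define R where "R = {d\<in>E'. j < d}"
          define Ej where "Ej = {d\<in>E'. d < j}"
          define F where "F = {d. d < j \<and> w t d = z}"
          define Gj where "Gj = {d. d < j \<and> w t d = g}"
          have Rg: "w t d = g" if "d \<in> R" for d
          proof -
            have d: "d \<in> E" "d \<noteq> e" "j < d" using that by (auto simp: R_def E'_def)
            then have "d < e" using E by (auto simp: less_Suc_eq)
            moreover have "w t d \<noteq> z"
            proof
              assume "w t d = z"
              then have "d \<in> J" using d j by (auto simp: J_def C_def)
              then show False using jmax[of d] d by simp
            qed
            ultimately show ?thesis using gz(4) by blast
          qed
          have two: "(\<forall>L L'. psi L (insert j Ej) + psi L' F + 1 \<le> A) \<or>
              (\<forall>L L'. psi L Ej + psi L' F + 2 ^ card R \<le> A)"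
            unfolding A_def Ej_def
          proof (rule two_stage[OF bnd ht P, where z = z and g = g and x = x])
            show "E' \<subseteq> {..<e}" using E by (auto simp: E'_def less_Suc_eq)
          qed (use Ex j gz Rg in \<open>auto simp: E'_def F_def R_def\<close>)
          have finj: "finite Ej" "finite R" using finE by (auto simp: Ej_def R_def E'_def)
          define W where "W = sum (weight k) Ej"
          have highR: "\<forall>n\<in>R. tri k \<le> n"
            using j tri_mono[of k "Suc k"] by (auto simp: R_def)
          have wR: "sum (weight k) R = int (card R) * X" using sum_weight_high[OF highR] by (simp add: X_def)
          have wj: "weight k j = X" using j(2) tri_mono[of k "Suc k"] weight_high[of k j] by (simp add: X_def)
          have Edec: "E = insert e (insert j (R \<union> Ej))"
            using eE j by (auto simp: R_def Ej_def E'_def)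
          have nin: "j \<notin> R \<union> Ej" "e \<notin> insert j (R \<union> Ej)" "R \<inter> Ej = {}"
            using je by (auto simp: R_def Ej_def E'_def)
          have "sum (weight k) E = weight k e + (weight k j + (sum (weight k) R + W))"
            using arg_cong[OF Edec, of "sum (weight k)"] nin finj
            by (simp add: sum.union_disjoint W_def)
          then have WE: "sum (weight k) E = W + int (card R) * X + 2 * X" using we wj wR by simp
          define Cj where "Cj = {n\<in>Ej. tri (Suc k) \<le> n}"
          have Cdec: "C = insert e (insert j (R \<union> Cj))"
            using eC j by (auto simp: R_def Cj_def Ej_def E'_def C_def)
          have "Cj \<subseteq> Ej" by (auto simp: Cj_def)
          then have nin': "j \<notin> R \<union> Cj" "e \<notin> insert j (R \<union> Cj)" "R \<inter> Cj = {}" "finite Cj"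
            using nin finj finite_subset by auto
          have "card C = Suc (Suc (card R + card Cj))"
            using arg_cong[OF Cdec, of card] nin' finj by (simp add: card_Un_disjoint)
          then have cC: "int (card C) * X = int (card R) * X + int (card Cj) * X + 2 * X"
            by (simp add: algebra_simps)
          \<comment> \<open>All disks smaller than \<open>j\<close>, in \<open>E\<close> or not, lie
            on \<open>z\<close> or \<open>g\<close> at \<open>t\<close>. Among them are the first
            \<open>tri (Suc k)\<close>, of total weight \<open>offset (Suc k)\<close>, and those of
            \<open>Cj\<close>.\<close>
          have FG: "offset (Suc k) + int (card Cj) * X \<le> sum (weight k) F + sum (weight k) Gj"
          proof -
            have "offset (Suc k) + int (card Cj) * X = sum (weight k) {..<tri (Suc k)} + sum (weight k) Cj"
              using sum_weight_high[of Cj k] tri_mono[of k "Suc k"] by (auto simp: sum_weight_tri Cj_def X_def)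
            also have "\<dots> = sum (weight k) ({..<tri (Suc k)} \<union> Cj)"
              using finj by (subst sum.union_disjoint) (auto simp: Cj_def)
            also have "\<dots> \<le> sum (weight k) {..<j}"
              using j by (intro sum_weight_mono) (auto simp: Cj_def Ej_def)
            also have "{..<j} = F \<union> Gj"
            proof (intro equalityI subsetI)
              fix d assume "d \<in> {..<j}"
              then show "d \<in> F \<union> Gj" using gz(4)[of d] je by (auto simp: F_def Gj_def)
            qed (auto simp: F_def Gj_def)
            also have "sum (weight k) (F \<union> Gj) = sum (weight k) F + sum (weight k) Gj"
              using gz(3) by (subst sum.union_disjoint) (auto simp: F_def Gj_def)
            finally show ?thesis .
          qed
          have GR: "sum (weight k) Gj + int (card R) * X \<le> sum (weight k) G"
          proof -
            have "sum (weight k) Gj + int (card R) * X = sum (weight k) (Gj \<union> R)"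
              unfolding wR[symmetric] using finj
              by (subst sum.union_disjoint) (auto simp: Gj_def R_def)
            also have "\<dots> \<le> sum (weight k) G"
            proof (intro sum_weight_mono finG subsetI)
              fix d assume "d \<in> Gj \<union> R"
              then show "d \<in> G" using Rg[of d] je E by (auto simp: Gj_def G_def R_def E'_def less_Suc_eq)
            qed
            finally show ?thesis .
          qed
          define r where "r = int (card R)"
          define c where "c = int (card Cj)"
          have goal': "psi (Suc k) E = W + 2 * (r * X) + c * X + 4 * X - offset (Suc k)"
            using goal WE cC by (simp add: psi_def r_def c_def)
          have Gpos: "0 \<le> sum (weight k) Gj" using weight_pos by (intro sum_nonneg) (auto simp: less_imp_le)
          have "offset k = (int k - 1) * X + 1" by (simp add: offset_def X_def)
          then have offk: "offset k = int k * X - X + 1" "offset (Suc k) = 2 * (int k * X) + 1"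
            using offset(1) by (simp_all add: algebra_simps)
          have kX: "int k * X + X \<le> r * X" if "k < card R"
          proof -
            have "(int k + 1) * X \<le> r * X" using that X unfolding r_def by (intro mult_right_mono) auto
            then show ?thesis by (simp add: algebra_simps)
          qed
          have rX: "r * X + X \<le> int k * X" if "card R < k"
          proof -
            have "(r + 1) * X \<le> int k * X" using that X unfolding r_def by (intro mult_right_mono) auto
            then show ?thesis by (simp add: algebra_simps)
          qed
          have G1: "sum (weight k) Gj + r * X - offset k \<le> B" using G[of k] GR by (simp add: psi_def r_def)
          have FG1: "offset (Suc k) + c * X \<le> sum (weight k) F + sum (weight k) Gj" using FG by (simp add: c_def)
          show ?thesis
          proof (cases "k < card R")
            case True
            \<comment> \<open>\<open>R\<close> alone forces \<open>B\<close> to be at least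
              \<open>2 * X - 1\<close>; together with the departure of \<open>e\<close> this pays
              for the weight \<open>2 * X\<close> of \<open>e\<close>.\<close>
            have "psi (Suc k) E' = psi (Suc k) E - 2 * X" using WE'[of "Suc k"] we by (simp add: psi_def)
            then show ?thesis
              using E'[of "Suc k"] AB G1 Gpos kX[OF True] offk X by linarith
          next
            case False
            then have rk: "r * X \<le> int k * X" using X unfolding r_def by (intro mult_right_mono) auto
            \<comment> \<open>Now \<open>r \<le> k\<close>. Adding the bounds at cap
              \<open>k\<close> leaves the slack \<open>(k - r) * X + 1\<close> in the first
              alternative and \<open>(k - r) * X - X + 2 ^ r\<close> in the second; the latter is 0
              for \<open>r = k\<close>.\<close>
            from two show ?thesis
            proof
              assume "\<forall>L L'. psi L (insert j Ej) + psi L' F + 1 \<le> A"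
              then have "psi k (insert j Ej) + psi k F + 1 \<le> A" by blast
              moreover have "sum (weight k) (insert j Ej) = W + X"
                using finj wj by (subst sum.insert) (auto simp: Ej_def W_def)
              ultimately show ?thesis using AB G1 FG1 goal' offk rk X unfolding psi_def by linarith
            next
              assume "\<forall>L L'. psi L Ej + psi L' F + 2 ^ card R \<le> A"
              then have *: "psi k Ej + psi k F + 2 ^ card R \<le> A" by blast
              show ?thesis
              proof (cases "card R = k")
                case True
                then have "r * X = int k * X" "(2::int) ^ card R = X" by (auto simp: r_def X_def)
                then show ?thesis using * AB G1 FG1 goal' offk X unfolding psi_def W_def by linarith
              next
                case False
                then have "r * X + X \<le> int k * X" using rX \<open>\<not> k < card R\<close> by simp
                moreover have "(1::int) \<le> 2 ^ card R" by simp
                ultimately show ?thesis using * AB G1 FG1 goal' offk X unfolding psi_def W_def by linarith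
              qed
            qed
          qed
        qed
      qed
    qed
  qed
  then show "psi L E \<le> int (move_count {..<Suc e} w a b)" by (simp add: M_def)
qed

theorem tower_bound:
  assumes "card P = 4"
  shows "tower_bound P N"
proof (induction N rule: less_induct)
  case (less N)
  show ?case
  proof (cases N)
    case 0
    show ?thesis unfolding tower_bound_def
    proof (intro allI impI)
      fix w :: "nat \<Rightarrow> nat \<Rightarrow> nat" and a b x y E L assume "E \<subseteq> {..<N}"
      then have "E = {}" using 0 by auto
      then show "psi L E \<le> int (move_count {..<N} w a b)" using offset_nonneg[of L] by (simp add: psi_def)
    qed
  next
    case (Suc e)
    then show ?thesis using tower_bound_step[OF _ assms, of e] less by blast
  qed
qed

subsection \<open>Arbitrarily many pegs\<close>

text \<open>Only the relative sizes of the disks matter: the increasing enumeration of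
  \<open>S\<close> carries bounds for initial segments over to arbitrary finite sets.\<close>

lemma relabel:
  assumes "finite S" and h: "hanoi_path S P w a b" and mvd: "\<forall>d\<in>S. moved w a b d"
  obtains v where "hanoi_path {..<card S} P v a b" "move_count {..<card S} v a b = move_count S w a b"
    "\<forall>d<card S. moved v a b d"
proof -
  obtain g where g: "bij_betw g {..<card S} S" "strict_mono_on {..<card S} g"
    using ex_bij_betw_strict_mono_card[OF assms(1)] by blast
  define v where "v i k = w i (g k)" for i k
  have inS: "g k \<in> S" if "k < card S" for k
    using g that by (auto simp: bij_betw_def)
  have img: "S = g ` {..<card S}" using g by (auto simp: bij_betw_def)
  have ne: "g d \<noteq> g D" if "d \<noteq> D" "d < card S" "D < card S" for d D
    using g that by (auto simp: bij_betw_def inj_on_def)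
  have less: "g d < g D" if "d < D" "D < card S" for d D
    using g(2) that by (auto simp: strict_mono_on_def)
  show thesis
  proof (rule that[of v])
    show "hanoi_path {..<card S} P v a b"
      unfolding hanoi_path_def
    proof (intro conjI allI impI)
      show "a \<le> b" by (rule hanoi_path_le[OF h])
      fix i d assume "a \<le> i" "i \<le> b" "d \<in> {..<card S}"
      then show "v i d \<in> P" unfolding v_def by (intro hanoi_path_in[OF h]) (auto intro: inS)
    next
      fix i D d assume *: "a \<le> i" "i < b" "D \<in> {..<card S}" "d \<in> {..<card S}" "d \<noteq> D" "v (Suc i) D \<noteq> v i D"
      then have **: "g D \<in> S" "g d \<in> S" "g d \<noteq> g D" "w (Suc i) (g D) \<noteq> w i (g D)"
        using inS ne by (auto simp: v_def)
      show "v (Suc i) d = v i d" unfolding v_def by (rule hanoi_path_others[OF h *(1,2) **])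
      assume "d < D"
      then have "g d < g D" using less * by simp
      then show "v i d \<noteq> v i D" "v i d \<noteq> v (Suc i) D"
        unfolding v_def using hanoi_path_smaller[OF h *(1,2) **(1,2) _ **(4)] by auto
    qed
    have "(\<exists>d\<in>{..<card S}. v (Suc i) d \<noteq> v i d) \<longleftrightarrow> (\<exists>d\<in>S. w (Suc i) d \<noteq> w i d)" for i
      unfolding v_def by (subst (2) img) blast
    then show "move_count {..<card S} v a b = move_count S w a b" unfolding move_count_def by simp
    show "\<forall>d<card S. moved v a b d" using mvd inS by (auto simp: moved_def v_def)
  qed
qed

text \<open>The final configuration may leave no peg empty. Instead the path is stopped when the
  largest disk \<open>q\<close> of \<open>Q\<close> first leaves \<open>y\<close>: two pegs are then
  free of smaller disks. This costs only the weight of \<open>q\<close>, at most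
  \<open>2 ^ L\<close>.\<close>

lemma part_after:
  assumes P: "card P = 4" and h: "hanoi_path {..<n} P w t b"
    and Q: "Q \<subseteq> {..<n}" "\<And>d. d \<in> Q \<Longrightarrow> w t d = y" "\<And>d. d \<in> Q \<Longrightarrow> moved w t b d"
  shows "psi L Q - 2 ^ L \<le> int (move_count {..<n} w t b)"
proof (cases "Q = {}")
  case True
  have "(0::int) \<le> 2 ^ L" by simp
  then show ?thesis unfolding psi_def True sum.empty using offset_nonneg[of L] by linarith
next
  case False
  have finQ: "finite Q" using Q(1) finite_subset by blast
  define q where "q = Max Q"
  have q: "q \<in> Q" "\<And>d. d \<in> Q \<Longrightarrow> d \<le> q" using False finQ by (auto simp: q_def)
  obtain k where k: "t \<le> k" "k \<le> b" "w k q \<noteq> y"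
  proof -
    obtain i where i: "t \<le> i" "i < b" "w (Suc i) q \<noteq> w i q" using Q(3)[OF q(1)] by (auto simp: moved_def)
    show thesis using that[of i] that[of "Suc i"] i by (cases "w i q = y") auto
  qed
  obtain s where s: "t \<le> s" "s < k" "\<And>i. t \<le> i \<Longrightarrow> i \<le> s \<Longrightarrow> w i q = y" "w (Suc s) q \<noteq> y"
    using first_exit[of t k "\<lambda>i. w i q = y"] k Q(2)[OF q(1)] by metis
  have "psi L (Q - {q}) \<le> int (move_count {..<q} w t s)"
  proof (rule bound_before[OF tower_bound[OF P] h, where x = y])
    show "Q - {q} \<subseteq> {..<q}"
    proof
      fix d assume "d \<in> Q - {q}"
      then show "d \<in> {..<q}" using q(2)[of d] by auto
    qed
  qed (use Q q s k in auto)
  also have "move_count {..<q} w t s \<le> move_count {..<q} w t b" using s k by (intro move_count_subinterval) auto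
  also have "move_count {..<q} w t b \<le> move_count {..<n} w t b" using q Q(1) by (intro move_count_mono) auto
  finally show ?thesis
    using finQ q(1) weight_le[of L q] by (simp add: psi_def sum_diff1)
qed

lemma part_before:
  assumes P: "card P = 4" and h: "hanoi_path {..<n} P w a t"
    and Q: "Q \<subseteq> {..<n}" "\<And>d. d \<in> Q \<Longrightarrow> w t d = y" "\<And>d. d \<in> Q \<Longrightarrow> moved w a t d"
  shows "psi L Q - 2 ^ L \<le> int (move_count {..<n} w a t)"
proof -
  have "psi L Q - 2 ^ L \<le> int (move_count {..<n} (\<lambda>i. w (a + t - i)) a t)"
    by (rule part_after[OF P hanoi_path_rev[OF h] Q(1), of y]) (use Q moved_rev[of w a t] in auto)
  then show ?thesis using move_count_rev[OF hanoi_path_le[OF h], of "{..<n}" w] by simp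
qed

lemma sum_weight_init:
  "sum (weight L) {..<tri (Suc L) + k} = offset L + int (L + 1 + k) * 2 ^ L"
proof -
  have "{..<tri (Suc L) + k} = {..<tri (Suc L)} \<union> {tri (Suc L)..<tri (Suc L) + k}" by auto
  then have "sum (weight L) {..<tri (Suc L) + k} = sum (weight L) {..<tri (Suc L)} + sum (weight L) {tri (Suc L)..<tri (Suc L) + k}"
    by (metis finite_atLeastLessThan finite_lessThan ivl_disj_int_one(2) sum.union_disjoint)
  also have "sum (weight L) {tri (Suc L)..<tri (Suc L) + k} = int k * 2 ^ L"
    using sum_weight_high[of "{tri (Suc L)..<tri (Suc L) + k}" L] tri_mono[of L "Suc L"] by auto
  finally show ?thesis by (simp add: sum_weight_tri offset_Suc algebra_simps)
qed

lemma four_pegs: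
  assumes P: "card P = 4" and h: "hanoi_path {..<tri (L + 4) + t} P w a b"
    and mvd: "\<forall>d<tri (L + 4) + t. moved w a b d"
  shows "int (L + t + 5) * 2 ^ L \<le> 2 * int (move_count {..<tri (L + 4) + t} w a b)"
proof -
  \<comment> \<open>\<open>n\<close> is the largest disk; its number is written in the form that
    \<open>sum_weight_init\<close> needs for the cap \<open>L\<close>.\<close>
  define n where "n = tri (Suc L) + (3 * L + 8 + t)"
  have n: "tri (L + 4) + t = Suc n" by (simp add: n_def tri_Suc eval_nat_numeral)
  have hS: "hanoi_path {..<Suc n} P w a b" using h n by simp
  have "moved w a b n" using mvd n by simp
  then obtain s where s: "a \<le> s" "s < b" "w (Suc s) n \<noteq> w s n" by (auto simp: moved_def)
  have "w s n \<in> P" "w (Suc s) n \<in> P" using hanoi_path_in[OF hS] s by auto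
  then have "card (P - {w s n, w (Suc s) n}) = 2" using P s(3) by (subst card_Diff_subset) auto
  then obtain y z where yz: "P - {w s n, w (Suc s) n} = {y, z}" "y \<noteq> z" by (metis card_2_iff)
  have pos: "w s d = y \<or> w s d = z" if "d < n" for d
    using off_when_moving[OF hS s(1,2) _ s(3), of d] that yz by auto
  have hb: "hanoi_path {..<n} P w a s" "hanoi_path {..<n} P w s b" using hanoi_path_mono[OF hS] s by simp_all
  define B where "B q = {d. d < n \<and> w s d = q \<and> moved w a s d}" for q
  define A where "A q = {d. d < n \<and> w s d = q \<and> \<not> moved w a s d}" for q
  have Bb: "psi L (B q) - 2 ^ L \<le> int (move_count {..<n} w a s)" for q
    by (rule part_before[OF P hb(1), of _ q]) (auto simp: B_def)
  have Ab: "psi L (A q) - 2 ^ L \<le> int (move_count {..<n} w s b)" for q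
  proof (rule part_after[OF P hb(2), of _ q])
    show "moved w s b d" if "d \<in> A q" for d
      using moved_split[of w a b d s] that mvd n by (auto simp: A_def)
  qed (auto simp: A_def)
  have AB: "sum (weight L) (B q \<union> A q) = sum (weight L) (B q) + sum (weight L) (A q)" for q
    by (intro sum.union_disjoint) (auto simp: A_def B_def)
  have "{..<n} = (B y \<union> A y) \<union> (B z \<union> A z)" using pos by (auto simp: A_def B_def)
  then have "sum (weight L) {..<n} = sum (weight L) ((B y \<union> A y) \<union> (B z \<union> A z))" by simp
  also have "\<dots> = sum (weight L) (B y \<union> A y) + sum (weight L) (B z \<union> A z)"
    using yz(2) by (intro sum.union_disjoint) (auto simp: A_def B_def)
  finally have W: "sum (weight L) {..<n} = sum (weight L) (B y) + sum (weight L) (A y) + (sum (weight L) (B z) + sum (weight L) (A z))"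
    by (simp only: AB)
  have init: "sum (weight L) {..<n} = offset L + int (4 * L + 9 + t) * 2 ^ L"
    unfolding n_def sum_weight_init by simp
  have o: "offset L = int L * 2 ^ L - 2 ^ L + 1" by (simp add: offset_def algebra_simps)
  have "move_count {..<n} w a s + move_count {..<n} w s b + 1 \<le> move_count {..<Suc n} w a b"
  proof -
    have hs: "hanoi_path {..<Suc n} P w s b" using hanoi_path_mono[OF hS] s by simp
    have "move_count {..<n} w s b + move_count {n} w s b \<le> move_count {..<Suc n} w s b"
      by (rule move_count_disjoint[OF hs]) auto
    moreover have "1 \<le> move_count {n} w s b" using s by (intro move_count_step[of n _ s s]) auto
    moreover have "move_count {..<n} w a s \<le> move_count {..<Suc n} w a s" by (intro move_count_mono) auto
    moreover have "move_count {..<Suc n} w a b = move_count {..<Suc n} w a s + move_count {..<Suc n} w s b"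
      using s by (intro move_count_split) auto
    ultimately show ?thesis by linarith
  qed
  then have "2 * int (move_count {..<n} w a s) + 2 * int (move_count {..<n} w s b) + 2 \<le> 2 * int (move_count {..<Suc n} w a b)"
    by linarith
  \<comment> \<open>The four parts subtract \<open>4 * offset L\<close> and
    \<open>4 * 2 ^ L\<close>, while the total weight contributes one \<open>offset L\<close>. Each
    half of the path is bounded by two of the parts, hence the factor 2.\<close>
  moreover have "int (4 * L + 9 + t) * 2 ^ L - 3 * offset L - 4 * 2 ^ L \<le> 2 * int (move_count {..<n} w a s) + 2 * int (move_count {..<n} w s b)"
    using Bb[of y] Bb[of z] Ab[of y] Ab[of z] W init unfolding psi_def by linarith
  moreover have "int (4 * L + 9 + t) * 2 ^ L - 3 * offset L - 4 * 2 ^ L = int (L + t + 5) * 2 ^ L + 3 * 2 ^ L - 3"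
    unfolding o by (simp add: algebra_simps)
  moreover have "(1::int) \<le> 2 ^ L" by simp
  ultimately show ?thesis unfolding n by linarith
qed

section \<open>Induction on the number of pegs\<close>

text \<open>With \<open>p = q + 4\<close> pegs; a number of disks is decomposed as \<open>disks q m t + r\<close>.\<close>

definition disks :: "nat \<Rightarrow> nat \<Rightarrow> nat \<Rightarrow> nat" where
  "disks q m t = (m + q + 1 choose (q + 2)) + (t + q choose (q + 1))"

text \<open>
  The summand \<open>1\<close> in \<open>m + t + 1\<close> is needed for the induction: without it the bound does not survive
  the step from \<open>q\<close> to \<open>q + 1\<close> for \<open>t = m - 1\<close>.
\<close>

definition scatter_bound :: "nat \<Rightarrow> nat \<Rightarrow> nat \<Rightarrow> bool" where
  "scatter_bound q m t \<longleftrightarrow> (\<forall>S P w a b. finite S \<longrightarrow> card P = q + 4 \<longrightarrow> hanoi_path S P w a b \<longrightarrow>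
     (\<forall>d\<in>S. moved w a b d) \<longrightarrow> disks q m t \<le> card S \<longrightarrow>
     (m + t + 1) * 2 ^ m \<le> 2 ^ (2 * q + 5) * move_count S w a b)"

lemma scatter_boundD:
  assumes "scatter_bound q m t" "finite S" "card P = q + 4" "hanoi_path S P w a b"
    "\<forall>d\<in>S. moved w a b d" "disks q m t \<le> card S"
  shows "(m + t + 1) * 2 ^ m \<le> 2 ^ (2 * q + 5) * move_count S w a b"
  using assms unfolding scatter_bound_def by blast

lemma disks_0: "disks 0 m t = tri m + t"
proof -
  have "Suc m choose Suc (Suc 0) = tri m"
    by (induction m) (simp_all add: tri_Suc)
  then show ?thesis by (simp add: disks_def numeral_2_eq_2)
qed

lemma disks_pos: "1 \<le> m \<Longrightarrow> 1 \<le> disks q m t"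
  using zero_less_binomial[of "q + 2" "m + q + 1"] unfolding disks_def by linarith

text \<open>Each disk moves at least once, which is enough for small \<open>m\<close>.\<close>

lemma scatter_small:
  assumes "(m + t + 1) * 2 ^ m \<le> 2 ^ (2 * q + 5) * disks q m t"
  shows "scatter_bound q m t"
  unfolding scatter_bound_def
proof (intro allI impI)
  fix S P w a b
  assume *: "finite S" "hanoi_path S P w a b" "\<forall>d\<in>S. moved w a b d" "disks q m t \<le> card S"
  have "disks q m t \<le> move_count S w a b" using move_count_ge_card[OF *(1,2,3)] *(4) by simp
  then have "2 ^ (2 * q + 5) * disks q m t \<le> 2 ^ (2 * q + 5) * move_count S w a b" by (rule mult_le_mono2)
  then show "(m + t + 1) * 2 ^ m \<le> 2 ^ (2 * q + 5) * move_count S w a b" using assms by (rule order_trans[rotated])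
qed

text \<open>With \<open>m = L + 4\<close> this is 16 times \<open>four_pegs\<close>; for
  \<open>m < 4\<close> counting the disks suffices. For \<open>m = 0\<close> the bound would demand
  a move although there need be no disk.\<close>

lemma scatter_four:
  assumes "1 \<le> m" "t \<le> m"
  shows "scatter_bound 0 m t"
proof (cases "4 \<le> m")
  case True
  then obtain L where L: "m = L + 4" by (metis add.commute le_Suc_ex)
  show ?thesis unfolding scatter_bound_def
  proof (intro allI impI)
    fix S P :: "nat set" and w a b
    assume *: "finite S" "card P = 0 + 4" "hanoi_path S P w a b" "\<forall>d\<in>S. moved w a b d" "disks 0 m t \<le> card S"
    obtain T where T: "T \<subseteq> S" "card T = tri (L + 4) + t" "finite T"
      using *(5) L obtain_subset_with_card_n[of "tri (L + 4) + t" S] by (auto simp: disks_0)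
    have hT: "hanoi_path T P w a b" using hanoi_path_mono[OF *(3) T(1)] hanoi_path_le[OF *(3)] by simp
    have mT: "\<forall>d\<in>T. moved w a b d" using *(4) T(1) by blast
    from relabel[OF T(3) hT mT] obtain v where
      v: "hanoi_path {..<card T} P v a b" "move_count {..<card T} v a b = move_count T w a b" "\<forall>d<card T. moved v a b d" .
    have "int (L + t + 5) * 2 ^ L \<le> 2 * int (move_count T w a b)"
      using four_pegs[of P L t v a b] *(2) v unfolding T(2) by simp
    then have "int ((L + t + 5) * 2 ^ L) \<le> int (2 * move_count T w a b)" by simp
    then have "(L + t + 5) * 2 ^ L \<le> 2 * move_count T w a b" by (simp only: of_nat_le_iff)
    also have "move_count T w a b \<le> move_count S w a b" by (rule move_count_mono[OF T(1)])
    finally have "16 * ((L + t + 5) * 2 ^ L) \<le> 16 * (2 * move_count S w a b)"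
      by (intro mult_le_mono2) simp
    also have "16 * ((L + t + 5) * 2 ^ L) = (m + t + 1) * 2 ^ m"
      by (simp add: L power_add)
    finally show "(m + t + 1) * 2 ^ m \<le> 2 ^ (2 * 0 + 5) * move_count S w a b"
      by (simp add: numeral_eq_Suc)
  qed
next
  case False
  then have "m = 1 \<or> m = 2 \<or> m = 3" using assms by auto
  then show ?thesis using assms
    by (intro scatter_small) (auto simp: disks_0 tri_Suc eval_nat_numeral)
qed

text \<open>\<open>split_or_block\<close> with \<open>K = disks q m1 t1\<close>. After a split the
  bound for \<open>m2\<close>, \<open>t2\<close> holds in both halves, whence the factor 2 in
  \<open>v2\<close>; with a blocked peg the constant \<open>2 ^ (2 * q + 5)\<close> is smaller by
  the factor 4 of \<open>v1\<close>.\<close>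

lemma scatter_rec:
  assumes b1: "scatter_bound q m1 t1" and b2: "scatter_bound (Suc q) m2 t2"
    and K: "1 \<le> disks q m1 t1" "disks q m1 t1 + disks (Suc q) m2 t2 \<le> disks (Suc q) m t"
    and v1: "(m + t + 1) * 2 ^ m \<le> 4 * ((m1 + t1 + 1) * 2 ^ m1)"
    and v2: "(m + t + 1) * 2 ^ m \<le> 2 * ((m2 + t2 + 1) * 2 ^ m2)"
  shows "scatter_bound (Suc q) m t"
  unfolding scatter_bound_def
proof (intro allI impI)
  fix S P :: "nat set" and w a b
  assume *: "finite S" "card P = Suc q + 4" "hanoi_path S P w a b" "\<forall>d\<in>S. moved w a b d" "disks (Suc q) m t \<le> card S"
  have pow: "(2::nat) ^ (2 * Suc q + 5) = 4 * 2 ^ (2 * q + 5)"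
    by (simp add: power_add power_mult)
  have le: "disks q m1 t1 \<le> card S" using K(2) *(5) by linarith
  show "(m + t + 1) * 2 ^ m \<le> 2 ^ (2 * Suc q + 5) * move_count S w a b"
    using *(3,1,4) K(1) le
  proof (cases rule: split_or_block)
    case (split s S1 S2)
    have "hanoi_path S1 P w a s" "hanoi_path S2 P w s b" using hanoi_path_mono[OF *(3)] split by simp_all
    moreover have "finite S1" "finite S2"
      using finite_subset[OF split(3) *(1)] finite_subset[OF split(4) *(1)] .
    moreover have "disks (Suc q) m2 t2 \<le> card S1" "disks (Suc q) m2 t2 \<le> card S2"
      using split K(2) *(5) by linarith+
    ultimately have "(m2 + t2 + 1) * 2 ^ m2 \<le> 2 ^ (2 * Suc q + 5) * move_count S1 w a s"
      "(m2 + t2 + 1) * 2 ^ m2 \<le> 2 ^ (2 * Suc q + 5) * move_count S2 w s b"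
      using scatter_boundD[OF b2 _ *(2)] split by blast+
    then have "2 * ((m2 + t2 + 1) * 2 ^ m2) \<le> 2 ^ (2 * Suc q + 5) * (move_count S1 w a s + move_count S2 w s b)"
      by (simp add: algebra_simps)
    also have "move_count S1 w a s + move_count S2 w s b \<le> move_count S w a s + move_count S w s b"
      using move_count_mono[OF split(3)] move_count_mono[OF split(4)] by (intro add_mono)
    also have "\<dots> = move_count S w a b" using move_count_split[OF split(1,2)] by simp
    finally show ?thesis using v2 by simp
  next
    case (block a' b' D z)
    have "card (P - {z}) = q + 4" using *(2) block(6) by simp
    moreover have "finite D" using finite_subset[OF block(4) *(1)] .
    ultimately have "(m1 + t1 + 1) * 2 ^ m1 \<le> 2 ^ (2 * q + 5) * move_count D w a' b'"
      using scatter_boundD[OF b1] block by blast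
    also have "move_count D w a' b' \<le> move_count D w a b" using block by (intro move_count_subinterval) auto
    also have "move_count D w a b \<le> move_count S w a b" using block by (intro move_count_mono) auto
    finally have "4 * ((m1 + t1 + 1) * 2 ^ m1) \<le> 4 * (2 ^ (2 * q + 5) * move_count S w a b)" by simp
    then show ?thesis using v1 unfolding pow by simp
  qed
qed


text \<open>Pascal's rule reduces the claim to
  \<open>t + q + 1 choose (q + 1) \<le> n + q + 1 choose (q + 1)\<close>. The two splittings that
  follow are in fact equalities.\<close>

lemma disks_split1: "t < n \<Longrightarrow> disks q n 0 + disks (Suc q) n (Suc t) \<le> disks (Suc q) (Suc n) t"
  using binomial_right_mono[of "t + q + 1" "n + q + 1" "q + 1"] by (simp add: disks_def binomial_eq_0)

lemma disks_split2: "disks q n 0 + disks (Suc q) (Suc n) 0 \<le> disks (Suc q) (Suc n) n"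
  by (simp add: disks_def binomial_eq_0)

lemma disks_split3: "disks q (Suc n) 0 + disks (Suc q) (Suc n) 0 \<le> disks (Suc q) (Suc n) (Suc n)"
  by (simp add: disks_def binomial_eq_0)

text \<open>Induction on \<open>m = Suc n\<close>. For \<open>t < n\<close> a split leads back to
  \<open>n\<close> and \<open>Suc t\<close>. This pair is out of range for \<open>t = n\<close> and
  \<open>t = Suc n\<close>, which use the case \<open>t = 0\<close> of the same \<open>m\<close>
  instead.\<close>

lemma scatter_Suc:
  assumes IH: "\<And>m t. 1 \<le> m \<Longrightarrow> t \<le> m \<Longrightarrow> scatter_bound q m t" and "1 \<le> m" "t \<le> m"
  shows "scatter_bound (Suc q) m t"
  using assms(2,3)
proof (induction m arbitrary: t rule: nat_induct_at_least)
  case base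
  have "(1 + t + 1) * 2 ^ 1 \<le> (2::nat) ^ 5 * 1" using base by simp
  also have "\<dots> \<le> 2 ^ (2 * Suc q + 5) * disks (Suc q) 1 t"
    using disks_pos[of 1 "Suc q" t] by (intro mult_le_mono power_increasing) auto
  finally show ?case by (rule scatter_small)
next
  case (Suc n)
  have low: "scatter_bound (Suc q) (Suc n) t" if "t < n" for t
  \<comment> \<open>Here \<open>v2\<close> is an equality, since
    \<open>n + Suc t = Suc n + t\<close>, and \<open>v1\<close> amounts to
    \<open>t \<le> n\<close>.\<close>
  proof (rule scatter_rec[of q n 0 n "Suc t"])
    show "scatter_bound q n 0" using IH Suc by simp
    show "scatter_bound (Suc q) n (Suc t)" using Suc that by simp
    show "1 \<le> disks q n 0" using Suc by (intro disks_pos)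
    show "disks q n 0 + disks (Suc q) n (Suc t) \<le> disks (Suc q) (Suc n) t" by (rule disks_split1[OF that])
  qed (use that in auto)
  have zero: "scatter_bound (Suc q) (Suc n) 0" using low[of 0] Suc by simp
  consider "t < n" | "t = n" | "t = Suc n" using Suc.prems by linarith
  then show ?case
  proof cases
    case 1
    then show ?thesis by (rule low)
  next
    case 2
    show ?thesis unfolding 2
    \<comment> \<open>Here \<open>v1\<close> is an equality; without the summand 1 it would amount
      to \<open>2 * n + 1 \<le> 2 * n\<close>.\<close>
    proof (rule scatter_rec[of q n 0 "Suc n" 0, OF _ zero _ disks_split2])
      show "scatter_bound q n 0" using IH Suc by simp
      show "1 \<le> disks q n 0" using Suc by (intro disks_pos)
    qed (auto simp: algebra_simps)
  next
    case 3
    show ?thesis unfolding 3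
    proof (rule scatter_rec[of q "Suc n" 0 "Suc n" 0, OF _ zero _ disks_split3])
      show "scatter_bound q (Suc n) 0" using IH Suc by simp
      show "1 \<le> disks q (Suc n) 0" by (intro disks_pos) simp
    qed (auto simp: algebra_simps)
  qed
qed

theorem scatter:
  assumes "1 \<le> m" "t \<le> m"
  shows "scatter_bound q m t"
  using assms
proof (induction q arbitrary: m t)
  case 0
  then show ?case by (rule scatter_four)
next
  case (Suc q)
  show ?case by (rule scatter_Suc[OF Suc.IH]) (use Suc.prems in auto)
qed

section \<open>From scattered disks to the tower problem\<close>

lemma move_count_le: "move_count S w a b \<le> b - a"
proof -
  have "move_count S w a b \<le> card {a..<b}" unfolding move_count_def by (intro card_mono) auto
  then show ?thesis by simp
qed

text \<open>The minimum is attained because the two towers are connected by moves, so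
  \<open>H p N\<close> is the length of an actual path.\<close>

lemma H_path:
  assumes "3 \<le> p"
  obtains w where "hanoi_path {..<N} {..<p} w 0 (H p N)" "\<forall>d<N. w 0 d = 0" "\<forall>d<N. w (H p N) d = 1"
proof -
  define Q where "Q n \<longleftrightarrow> (hanoi_tower N 0, hanoi_tower N 1) \<in> hanoi_moves p N ^^ n" for n
  have "(hanoi_tower N 0, hanoi_tower N 1) \<in> (hanoi_moves p N)\<^sup>*"
    using assms by (intro hanoi_tower_reachable) auto
  then have "\<exists>n. Q n" unfolding Q_def by (rule rtrancl_imp_relpow)
  then have "Q (H p N)" unfolding H_def hanoi_dist_def Q_def[symmetric] by (rule LeastI_ex)
  then obtain w where w: "w 0 = hanoi_tower N 0" "w (H p N) = hanoi_tower N 1"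
    "\<And>i. i < H p N \<Longrightarrow> (w i, w (Suc i)) \<in> hanoi_moves p N"
    unfolding Q_def relpow_fun_conv by blast
  have move: "\<exists>D y. w (Suc i) = (w i)(D := y) \<and> D < N \<and> y < p \<and> y \<noteq> w i D \<and>
      (\<forall>d<N. w i d < p) \<and> (\<forall>d<D. w i d \<noteq> w i D \<and> w i d \<noteq> y)" if "i < H p N" for i
  proof -
    note step = w(3)[OF that]
    obtain v D y where v: "w i = v" "w (Suc i) = v(D := y)" "v \<in> hanoi_configs p N" "D < N" "y < p"
        "y \<noteq> v D" "\<forall>d<D. v d \<noteq> v D \<and> v d \<noteq> y"
      using step unfolding hanoi_moves_def by auto
    moreover have "\<forall>d<N. w i d < p" using v(1,3) by (auto simp: hanoi_configs_def)
    ultimately show ?thesis by blast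
  qed
  \<comment> \<open>A move constrains only its source to be a configuration, so the last one is
    treated separately.\<close>
  have inP: "w i d < p" if "i \<le> H p N" "d < N" for i d
  proof (cases "i = H p N")
    case True
    then show ?thesis using w(2) that assms by (simp add: hanoi_tower_def)
  next
    case False
    then show ?thesis using move[of i] that by auto
  qed
  show thesis
  proof (rule that[of w])
    show "hanoi_path {..<N} {..<p} w 0 (H p N)" unfolding hanoi_path_def
    proof (intro conjI allI impI)
      fix i D d assume *: "i < H p N" "D \<in> {..<N}" "d \<in> {..<N}" "d \<noteq> D" "w (Suc i) D \<noteq> w i D"
      obtain D' y where m: "w (Suc i) = (w i)(D' := y)" "\<forall>d<D'. w i d \<noteq> w i D' \<and> w i d \<noteq> y"
        using move[OF *(1)] by blast
      have D': "D' = D" using *(5) m(1) by (cases "D' = D") auto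
      show "w (Suc i) d = w i d" using m D' *(4) by simp
      show "w i d \<noteq> w i D" "w i d \<noteq> w (Suc i) D" if "d < D" using m D' that by auto
    qed (use inP in auto)
  qed (use w in \<open>auto simp: hanoi_tower_def\<close>)
qed

lemma H_lower:
  assumes "scatter_bound q m t" "disks q m t \<le> M"
  shows "2 * ((m + t + 1) * 2 ^ m) \<le> 2 ^ (2 * q + 5) * H (q + 4) (Suc M)"
proof -
  define n where "n = H (q + 4) (Suc M)"
  obtain w where h: "hanoi_path {..<Suc M} {..<q + 4} w 0 n"
    and w0: "\<forall>d<Suc M. w 0 d = 0" and wn: "\<forall>d<Suc M. w n d = 1"
    using H_path[of "q + 4" "Suc M" thesis] unfolding n_def by simp
  obtain s where s: "s < n" "\<And>k. k \<le> s \<Longrightarrow> w k M = 0" "w (Suc s) M \<noteq> 0"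
    using first_exit[of 0 n "\<lambda>i. w i M = 0"] w0 wn by auto
  obtain u where u: "u < n" "w u M \<noteq> 1" "\<And>k. u < k \<Longrightarrow> k \<le> n \<Longrightarrow> w k M = 1"
    using last_exit[of 0 n "\<lambda>i. w i M \<noteq> 1"] w0 wn by auto
  have su: "s \<le> u"
  proof (rule ccontr)
    assume "\<not> s \<le> u"
    then show False using u(3)[of s] s(2)[of s] s(1) by auto
  qed
  have hs: "hanoi_path {..<M} {..<q + 4} w 0 s" "hanoi_path {..<M} {..<q + 4} w u n"
    using hanoi_path_mono[OF h] s u by simp_all
  \<comment> \<open>Peg 0 is free of smaller disks when \<open>M\<close> first leaves it, and peg 1
    when \<open>M\<close> last arrives there, so all smaller disks move in both phases.\<close>
  have ms: "moved w 0 s d" if "d < M" for d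
    using moved_change[of w 0 d s 0 s] off_when_moving[OF h, of s M d] that s w0 by auto
  have mu: "moved w u n d" if "d < M" for d
    using moved_change[of w u d n u n] off_when_moving[OF h, of u M d] that u wn by auto
  have "(m + t + 1) * 2 ^ m \<le> 2 ^ (2 * q + 5) * move_count {..<M} w 0 s"
    using scatter_boundD[OF assms(1) _ _ hs(1)] ms assms(2) by simp
  also have "\<dots> \<le> 2 ^ (2 * q + 5) * s" using move_count_le[of "{..<M}" w 0 s] by simp
  finally have 1: "(m + t + 1) * 2 ^ m \<le> 2 ^ (2 * q + 5) * s" .
  have "(m + t + 1) * 2 ^ m \<le> 2 ^ (2 * q + 5) * move_count {..<M} w u n"
    using scatter_boundD[OF assms(1) _ _ hs(2)] mu assms(2) by simp
  also have "\<dots> \<le> 2 ^ (2 * q + 5) * (n - u)" using move_count_le[of "{..<M}" w u n] by simp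
  finally have "2 * ((m + t + 1) * 2 ^ m) \<le> 2 ^ (2 * q + 5) * (s + (n - u))"
    using 1 by (simp add: algebra_simps)
  also have "\<dots> \<le> 2 ^ (2 * q + 5) * n" using su u(1) by (intro mult_le_mono2) simp
  finally show ?thesis by (simp only: n_def)
qed

section \<open>The decomposition of \<open>N - 1\<close> and the conclusion\<close>

lemma disks_Suc: "disks q m t + (t + q choose q) = disks q m (Suc t)"
  by (simp add: disks_def)

lemma disks_diag: "disks q m (Suc m) = disks q (Suc m) 0"
  by (simp add: disks_def binomial_eq_0)

lemma disks_mono: "t \<le> t' \<Longrightarrow> disks q m t \<le> disks q m t'"
  using binomial_right_mono[of "t + q" "t' + q" "q + 1"] by (simp add: disks_def)

lemma disks_mono0: "m \<le> m' \<Longrightarrow> disks q m 0 \<le> disks q m' 0"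
  using binomial_right_mono[of "m + q + 1" "m' + q + 1" "q + 2"] by (simp add: disks_def)

lemma disks_ge: "m \<le> disks q m 0"
proof (induction m)
  case (Suc m)
  have "1 \<le> m + q + 1 choose (q + 1)" using zero_less_binomial[of "q + 1" "m + q + 1"] by linarith
  then have "Suc (disks q m 0) \<le> disks q (Suc m) 0" by (simp add: disks_def)
  then show ?case using Suc by simp
qed simp

text \<open>The values \<open>disks q m t\<close> with \<open>t \<le> m\<close>, in lexicographic
  order, cut the natural numbers into consecutive blocks of length \<open>t + q choose q\<close>:
  the last block for \<open>m\<close> ends at \<open>disks q m (Suc m)\<close>, where the first one
  for \<open>Suc m\<close> begins.\<close>

lemma decomposition_ex1:
  "\<exists>!(m, t, r). t \<le> m \<and> r < (t + q choose q) \<and> n = disks q m t + r"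
proof -
  have d00: "disks q 0 0 = 0" by (simp add: disks_def)
  obtain m where m: "disks q m 0 \<le> n" "n < disks q (Suc m) 0"
    using first_exit[of 0 "Suc n" "\<lambda>m. disks q m 0 \<le> n"] disks_ge[of "Suc n" q] d00
    by (metis le_refl not_less not_less_eq_eq zero_le)
  obtain t where t: "t \<le> m" "disks q m t \<le> n" "n < disks q m (Suc t)"
    using first_exit[of 0 "Suc m" "\<lambda>t. disks q m t \<le> n"] m disks_diag[of q m]
    by (metis le_refl less_Suc_eq_le not_less zero_le)
  show ?thesis
  proof (rule ex1I[of _ "(m, t, n - disks q m t)"])
    show "case (m, t, n - disks q m t) of (m, t, r) \<Rightarrow> t \<le> m \<and> r < (t + q choose q) \<and> n = disks q m t + r"
      using t disks_Suc[of q m t] by auto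
    fix x assume "case x of (m, t, r) \<Rightarrow> t \<le> m \<and> r < (t + q choose q) \<and> n = disks q m t + r"
    then obtain m' t' r' where x: "x = (m', t', r')" "t' \<le> m'" "r' < (t' + q choose q)" "n = disks q m' t' + r'"
      by auto
    have n': "disks q m' t' \<le> n" "n < disks q m' (Suc t')" using x disks_Suc[of q m' t'] by auto
    then have "disks q m' 0 \<le> n" "n < disks q (Suc m') 0"
      using disks_mono[of 0 t' q m'] disks_mono[of "Suc t'" "Suc m'" q m'] x(2) disks_diag[of q m'] by auto
    then have "\<not> m < m'" "\<not> m' < m"
      using m disks_mono0[of "Suc m" m' q] disks_mono0[of "Suc m'" m q] by auto
    then have mm: "m' = m" by simp
    have "\<not> t < t'" "\<not> t' < t"
      using t n' disks_mono[of "Suc t" t' q m] disks_mono[of "Suc t'" t q m] unfolding mm by auto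
    then have "t' = t" by simp
    then show "x = (m, t, n - disks q m t)" using x mm by simp
  qed
qed

theorem theorem3:
  fixes p N :: nat
  assumes "p \<ge> 4" and "N \<ge> 1"
  shows "(\<exists>!(m, t, r). t \<le> m \<and> r < (t + p - 4) choose (p - 4) \<and>
            N - 1 = ((m + p - 3) choose (p - 2)) + ((t + p - 4) choose (p - 3)) + r) \<and>
         (\<forall>m t r. t \<le> m \<and> r < (t + p - 4) choose (p - 4) \<and>
            N - 1 = ((m + p - 3) choose (p - 2)) + ((t + p - 4) choose (p - 3)) + r \<longrightarrow>
            real (H p N) \<ge> real (m + t) * 2 powi (int m - 2 * (int p - 2)))"
proof -
  obtain q where q: "p = q + 4" using assms(1) by (metis add.commute le_Suc_ex)
  obtain M where M: "N = Suc M" using assms(2) by (cases N) auto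
  have eq: "m + p - 3 = m + q + 1" "p - 2 = q + 2" "t + p - 4 = t + q" "p - 3 = q + 1" "p - 4 = q" for m t
    using q by auto
  have bound: "real (m + t) * 2 powi (int m - 2 * (int p - 2)) \<le> real (H p N)"
    if "t \<le> m" "M = disks q m t + r" for m t r
  \<comment> \<open>\<open>scatter\<close> requires \<open>1 \<le> m\<close>; for
    \<open>m = 0\<close> also \<open>t = 0\<close>, and the bound is 0.\<close>
  proof (cases "m = 0")
    case True
    then show ?thesis using that by simp
  next
    case False
    then have "2 * ((m + t + 1) * 2 ^ m) \<le> 2 ^ (2 * q + 5) * H (q + 4) (Suc M)"
      using that by (intro H_lower scatter) auto
    then have "2 * ((m + t) * 2 ^ m) \<le> 2 ^ (2 * q + 5) * H p N" unfolding q M by simp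
    \<comment> \<open>The factor 2 from the two phases lowers the exponent to
      \<open>2 * q + 4\<close>, which is \<open>2 * (p - 2)\<close>.\<close>
    also have "2 ^ (2 * q + 5) * H p N = 2 * (2 ^ (2 * q + 4) * H p N)" by (simp add: power_add)
    finally have "(m + t) * 2 ^ m \<le> 2 ^ (2 * q + 4) * H p N" by simp
    then have "real ((m + t) * 2 ^ m) \<le> real (2 ^ (2 * q + 4) * H p N)" by (simp only: of_nat_le_iff)
    then have "real (m + t) * 2 ^ m / 2 ^ (2 * q + 4) \<le> real (H p N)"
      by (simp add: field_simps)
    moreover have "(2::real) powi (int m - 2 * (int p - 2)) = 2 ^ m / 2 ^ (2 * q + 4)"
    proof -
      have "int m - 2 * (int p - 2) = int m - int (2 * q + 4)" using q by simp
      then have "(2::real) powi (int m - 2 * (int p - 2)) = 2 powi (int m - int (2 * q + 4))"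
        by (simp only:)
      also have "\<dots> = 2 powi int m / 2 powi int (2 * q + 4)" by (rule power_int_diff) simp
      finally show ?thesis by (simp only: power_int_of_nat)
    qed
    ultimately show ?thesis by simp
  qed
  have "\<exists>!(m, t, r). t \<le> m \<and> r < (t + q choose q) \<and>
      M = (m + q + 1 choose (q + 2)) + (t + q choose (q + 1)) + r"
    using decomposition_ex1[of q M] unfolding disks_def .
  then show ?thesis using bound unfolding eq M disks_def by auto
qed

end
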